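(* Let $\mathbb{F}$ be a field and $d,r$ non-negative integers. If an $\mathbb{F}$-representable matroid $M$ has a rooted $(d,r)$-decomposition, then there exists an $\mathbb{F}$-representable matroid $N$ such that $M$ is a minor of $N$ and $\mathrm{cdd}(N)\le 2r\cdot(4^d-1)+1$.
   Context: For a matroid $M$ with rank function $r_M$ and disjoint sets $X,Y$ of elements, $\lambda_M(X,Y)=r_M(X)+r_M(Y)-r_M(X\cup Y)$. For pairwise disjoint sets $X_1,\dots,X_k$ of elements, $\lambda^*_M(X_1,\dots,X_k)=\max_{I\subseteq[k]}\lambda_M\big(\bigcup_{i\in I}X_i,\bigcup_{i\in[k]\setminus I}X_i\big)$. A rooted $(d,r)$-decomposition of $M$ is a rooted tree $T$ of depth $d$ (the depth being the maximum number of edges on a path from the root to a leaf) whose leaves are in one-to-one correspondence with the elements of $M$, such that for every inner vertex $v$ of $T$ with $k$ children, if $X_1,\dots,X_k$ are the sets of elements of $M$ assigned to the leaves of the $k$ subtrees rooted at the children of $v$, then $\lambda^*_M(X_1,\dots,X_k)\le r$. The contraction-deletion-depth $\mathrm{cdd}(M)$ is defined recursively: if $M$ has a single element, $\mathrm{cdd}(M)=1$; if $M$ is not connected, $\mathrm{cdd}(M)$ is the maximum of $\mathrm{cdd}$ over the components of $M$ (restrictions of $M$ to its components, a component being an inclusion-wise maximal set of elements any two of which lie in a common circuit); otherwise $\mathrm{cdd}(M)=1+\min_{e}\min\{\mathrm{cdd}(M/e),\mathrm{cdd}(M\setminus e)\}$, the minimum over elements $e$ of $M$. *)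

theory Defs
  imports Main
begin

text \<open>Matroids are given by a finite ground set E and a rank function rk
(only its values on subsets of E matter).\<close>

definition lin_indep :: "('a \<Rightarrow> nat \<Rightarrow> 'f::field) \<Rightarrow> 'a set \<Rightarrow> bool" where
  "lin_indep v Y \<longleftrightarrow>
     (\<forall>c :: 'a \<Rightarrow> 'f. (\<forall>i. (\<Sum>x\<in>Y. c x * v x i) = 0) \<longrightarrow> (\<forall>x\<in>Y. c x = 0))"

definition lin_rank :: "('a \<Rightarrow> nat \<Rightarrow> 'f::field) \<Rightarrow> 'a set \<Rightarrow> nat" where
  "lin_rank v X = Max {card Y | Y. Y \<subseteq> X \<and> lin_indep v Y}"

text \<open>(E, rk) is represented by the columns v x (x in E) of a matrix over 'f
with m rows.\<close>
definition representable :: "'f::field itself \<Rightarrow> 'a set \<Rightarrow> ('a set \<Rightarrow> nat) \<Rightarrow> bool" where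
  "representable _ E rk \<longleftrightarrow> finite E \<and>
     (\<exists>(v :: 'a \<Rightarrow> nat \<Rightarrow> 'f) (m::nat). (\<forall>x\<in>E. \<forall>i\<ge>m. v x i = 0) \<and>
        (\<forall>X\<subseteq>E. rk X = lin_rank v X))"

definition lam :: "('a set \<Rightarrow> nat) \<Rightarrow> 'a set \<Rightarrow> 'a set \<Rightarrow> nat" where
  "lam rk X Y = rk X + rk Y - rk (X \<union> Y)"

definition lam_star :: "('a set \<Rightarrow> nat) \<Rightarrow> 'i set \<Rightarrow> ('i \<Rightarrow> 'a set) \<Rightarrow> nat" where
  "lam_star rk P X = Max {lam rk (\<Union>i\<in>I. X i) (\<Union>i\<in>P - I. X i) | I. I \<subseteq> P}"

datatype 'a rtree = Leaf 'a | Node "'a rtree list"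

fun leaves :: "'a rtree \<Rightarrow> 'a list" where
  "leaves (Leaf x) = [x]"
| "leaves (Node ts) = concat (map leaves ts)"

fun depth :: "'a rtree \<Rightarrow> nat" where
  "depth (Leaf x) = 0"
| "depth (Node ts) = Suc (fold max (map depth ts) 0)"

fun width_ok :: "('a set \<Rightarrow> nat) \<Rightarrow> nat \<Rightarrow> 'a rtree \<Rightarrow> bool" where
  "width_ok rk k (Leaf x) = True"
| "width_ok rk k (Node ts) =
     (ts \<noteq> [] \<and> lam_star rk {..<length ts} (\<lambda>i. set (leaves (ts ! i))) \<le> k
      \<and> list_all (width_ok rk k) ts)"

definition rooted_decomposition ::
  "'a set \<Rightarrow> ('a set \<Rightarrow> nat) \<Rightarrow> nat \<Rightarrow> nat \<Rightarrow> 'a rtree \<Rightarrow> bool" where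
  "rooted_decomposition E rk d k T \<longleftrightarrow>
     distinct (leaves T) \<and> set (leaves T) = E \<and> depth T = d \<and> width_ok rk k T"

definition has_rooted_decomposition :: "'a set \<Rightarrow> ('a set \<Rightarrow> nat) \<Rightarrow> nat \<Rightarrow> nat \<Rightarrow> bool" where
  "has_rooted_decomposition E rk d k \<longleftrightarrow> (\<exists>T. rooted_decomposition E rk d k T)"

definition circuit :: "'a set \<Rightarrow> ('a set \<Rightarrow> nat) \<Rightarrow> 'a set \<Rightarrow> bool" where
  "circuit E rk C \<longleftrightarrow> C \<subseteq> E \<and> rk C < card C \<and> (\<forall>D. D \<subset> C \<longrightarrow> rk D = card D)"

definition component :: "'a set \<Rightarrow> ('a set \<Rightarrow> nat) \<Rightarrow> 'a set \<Rightarrow> bool" where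
  "component E rk S \<longleftrightarrow>
     (let P = (\<lambda>S. S \<subseteq> E \<and> (\<forall>x\<in>S. \<forall>y\<in>S. x \<noteq> y \<longrightarrow> (\<exists>C. circuit E rk C \<and> x \<in> C \<and> y \<in> C)))
      in P S \<and> (\<forall>S'. P S' \<and> S \<subseteq> S' \<longrightarrow> S' = S))"

definition connected_matroid :: "'a set \<Rightarrow> ('a set \<Rightarrow> nat) \<Rightarrow> bool" where
  "connected_matroid E rk \<longleftrightarrow> component E rk E"

definition contract_rk :: "('a set \<Rightarrow> nat) \<Rightarrow> 'a \<Rightarrow> 'a set \<Rightarrow> nat" where
  "contract_rk rk e X = rk (X \<union> {e}) - rk {e}"

definition is_minor :: "'a set \<Rightarrow> ('a set \<Rightarrow> nat) \<Rightarrow> 'b set \<Rightarrow> ('b set \<Rightarrow> nat) \<Rightarrow> bool" where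
  "is_minor E rk E' rk' \<longleftrightarrow>
     (\<exists>f C D. C \<subseteq> E' \<and> D \<subseteq> E' \<and> C \<inter> D = {} \<and> inj_on f E \<and> f ` E = E' - C - D \<and>
        (\<forall>X\<subseteq>E. rk X = rk' (f ` X \<union> C) - rk' C))"

inductive cdd_le :: "'a set \<Rightarrow> ('a set \<Rightarrow> nat) \<Rightarrow> nat \<Rightarrow> bool" where
  single: "card E = 1 \<Longrightarrow> 1 \<le> k \<Longrightarrow> cdd_le E rk k"
| disconnected: "card E \<noteq> 1 \<Longrightarrow> \<not> connected_matroid E rk \<Longrightarrow>
     (\<forall>S. component E rk S \<longrightarrow> cdd_le S rk k) \<Longrightarrow> cdd_le E rk k"
| contract: "card E \<noteq> 1 \<Longrightarrow> connected_matroid E rk \<Longrightarrow> e \<in> E \<Longrightarrow>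
     cdd_le (E - {e}) (contract_rk rk e) k \<Longrightarrow> cdd_le E rk (Suc k)"
| delete: "card E \<noteq> 1 \<Longrightarrow> connected_matroid E rk \<Longrightarrow> e \<in> E \<Longrightarrow>
     cdd_le (E - {e}) rk k \<Longrightarrow> cdd_le E rk (Suc k)"

definition cdd :: "'a set \<Rightarrow> ('a set \<Rightarrow> nat) \<Rightarrow> nat" where
  "cdd E rk = (LEAST k. cdd_le E rk k)"

end

theory Submission
  imports Defs HOL.Vector_Spaces "HOL-Library.Function_Algebras"
begin

text \<open>Let \<open>V\<^sub>1, \<dots>, V\<^sub>n\<close> be the subspaces spanned by the elements below the children of the root, and let
  \<open>U\<^sub>i\<close> be the intersection of \<open>V\<^sub>i\<close> with the sum of the earlier ones. Distributing the children
  greedily over two sides shows that the sum \<open>W\<close> of all \<open>U\<^sub>i\<close> has dimension at most \<open>3r\<close>. Projecting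
  the vectors in \<open>V\<^sub>i\<close> along \<open>U\<^sub>i\<close> onto a complement makes the blocks independent, raises each
  connectivity inside a block by at most \<open>3r\<close>, and changes the matrix by a matrix whose columns lie
  in \<open>W\<close>. Each of the at most \<open>3r\<close> rank-one changes is realised by two additional elements:
  contracting the first and deleting the second gives the old matroid, contracting the second and
  deleting the first gives the new one. Hence the bound \<open>c(d, r)\<close> satisfies
  \<open>c(d, r) \<le> 6r + c(d - 1, 4r)\<close> with \<open>c(0, r) = 1\<close>.\<close>

section \<open>Matroids and upper bounds on the contraction-deletion-depth\<close>

text \<open>The number of children is unbounded, so bounds on the single overlaps \<open>U i\<close>
  would not limit the number of new elements; only a bound on the dimension of their sum does. It is
  available because \<open>lam_star\<close> ranges over all bipartitions of the children, so the
  bipartition may be built to suit the overlaps.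

  Inside a block the connectivity grows from \<open>r\<close> to \<open>r + 3 * r\<close>, whence
  the base 4: \<open>2 * r * (4 ^ d - 1) + 1\<close> satisfies the recursion with equality.

  The changes of the matrix depend on the representation, so the induction constructs vectors rather
  than abstract matroids. Children are extended separately and then put side by side. To keep the
  blocks independent, the new elements use fresh coordinates above a floor that can be raised at
  will, and a deleted element may involve only the old vectors of its block and the contracted
  coordinates.\<close>

locale matroid_rank =
  fixes E :: "'a set" and rk :: "'a set \<Rightarrow> nat"
  assumes finite_ground: "finite E"
    and rk_le_card: "X \<subseteq> E \<Longrightarrow> rk X \<le> card X"
    and rk_mono: "X \<subseteq> Y \<Longrightarrow> Y \<subseteq> E \<Longrightarrow> rk X \<le> rk Y"
    and rk_submod: "X \<subseteq> E \<Longrightarrow> Y \<subseteq> E \<Longrightarrow> rk (X \<union> Y) + rk (X \<inter> Y) \<le> rk X + rk Y"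
begin

lemma rk_empty [simp]: "rk {} = 0"
  using rk_le_card[of "{}"] by simp

lemma finite_sub: "X \<subseteq> E \<Longrightarrow> finite X"
  using finite_ground finite_subset by blast

lemma rk_insert_le: "X \<subseteq> E \<Longrightarrow> e \<in> E \<Longrightarrow> rk (insert e X) \<le> Suc (rk X)"
  using rk_submod[of X "{e}"] rk_le_card[of "{e}"] by simp

lemma indep_subset:
  assumes "X \<subseteq> Y" "Y \<subseteq> E" "rk Y = card Y" shows "rk X = card X"
proof -
  have sub: "X \<subseteq> E" "Y - X \<subseteq> E" "X \<union> (Y - X) = Y" using assms by auto
  then have "rk Y \<le> rk X + rk (Y - X)" using rk_submod[of X "Y - X"] by simp
  moreover have "rk (Y - X) \<le> card (Y - X)" using rk_le_card sub by simp
  moreover have "card (Y - X) = card Y - card X" "card X \<le> card Y"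
    using assms(1) finite_sub[OF sub(1)] finite_sub[OF assms(2)] by (simp_all add: card_Diff_subset card_mono)
  moreover have "rk X \<le> card X" using rk_le_card sub by simp
  ultimately show ?thesis using assms(3) by linarith
qed

text \<open>Membership of \<open>x\<close> in the closure of \<open>Y\<close> is expressed as
  \<open>rk (insert x Y) = rk Y\<close>. Submodularity on \<open>Z\<close> and
  \<open>insert x Y\<close> transfers it to larger sets.\<close>

lemma closure_mono:
  assumes "rk (insert x Y) = rk Y" "Y \<subseteq> Z" "Z \<subseteq> E" "x \<in> E"
  shows "rk (insert x Z) = rk Z"
proof -
  have "rk (Z \<union> insert x Y) + rk (Z \<inter> insert x Y) \<le> rk Z + rk (insert x Y)"
    using rk_submod[of Z "insert x Y"] assms by blast
  moreover have "Z \<union> insert x Y = insert x Z" using assms by blast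
  moreover have "rk Y \<le> rk (Z \<inter> insert x Y)" using rk_mono[of Y "Z \<inter> insert x Y"] assms by blast
  moreover have "rk Z \<le> rk (insert x Z)" using rk_mono[of Z "insert x Z"] assms by blast
  ultimately show ?thesis using assms(1) by simp
qed

lemma basis_of: "Y \<subseteq> E \<Longrightarrow> \<exists>Z\<subseteq>Y. rk Z = card Z \<and> rk Z = rk Y"
proof (induction Y rule: infinite_finite_induct)
  case (infinite A)
  then show ?case using finite_sub by blast
next
  case empty
  then show ?case by simp
next
  case (insert y Y)
  then obtain Z where Z: "Z \<subseteq> Y" "rk Z = card Z" "rk Z = rk Y" by blast
  show ?case
  proof (cases "rk (insert y Y) = rk Y")
    case True
    then show ?thesis using Z by (metis subset_insertI2)
  next
    case False
    then have "rk (insert y Z) \<noteq> rk Z" using closure_mono[of y Z Y] Z insert by auto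
    moreover have "rk (insert y Z) \<le> Suc (rk Z)" "rk Z \<le> rk (insert y Z)"
      using rk_insert_le[of Z y] rk_mono[of Z "insert y Z"] Z insert by auto
    moreover have "rk (insert y Y) \<le> Suc (rk Y)" "rk (insert y Z) \<le> rk (insert y Y)"
      using rk_insert_le[of Y y] rk_mono[of "insert y Z" "insert y Y"] Z insert by auto
    moreover have "card (insert y Z) = Suc (card Z)"
      using Z insert by (metis card_insert_disjoint finite_subset subsetD)
    ultimately show ?thesis using Z by (intro exI[of _ "insert y Z"]) auto
  qed
qed

section \<open>Circuits and their elimination\<close>

lemma circuit_exists: "X \<subseteq> E \<Longrightarrow> rk X < card X \<Longrightarrow> \<exists>C\<subseteq>X. circuit E rk C"
proof (induction "card X" arbitrary: X rule: less_induct)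
  case less
  show ?case
  proof (cases "\<forall>D. D \<subset> X \<longrightarrow> rk D = card D")
    case True
    then show ?thesis using less.prems by (auto simp: circuit_def)
  next
    case False
    then obtain D where D: "D \<subset> X" "rk D \<noteq> card D" by blast
    then have "rk D < card D" "card D < card X" "D \<subseteq> E"
      using rk_le_card[of D] less.prems finite_sub by (auto simp: psubset_card_mono le_neq_implies_less)
    then show ?thesis using less.hyps D by (meson order_trans psubset_imp_subset)
  qed
qed

text \<open>Adding \<open>x\<close> to a basis of \<open>Y\<close> creates a dependent set, and a
  circuit in it must use \<open>x\<close> because the basis is independent.\<close>

lemma circuit_through:
  assumes "insert x Y \<subseteq> E" "x \<notin> Y" "rk (insert x Y) = rk Y"
  shows "\<exists>C. circuit E rk C \<and> x \<in> C \<and> C \<subseteq> insert x Y"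
proof -
  obtain Z where Z: "Z \<subseteq> Y" "rk Z = card Z" "rk Z = rk Y" using basis_of assms by blast
  have "rk (insert x Z) \<le> rk Y" using rk_mono[of "insert x Z" "insert x Y"] assms Z by auto
  moreover have "card (insert x Z) = Suc (card Z)"
    using Z assms finite_sub by (metis card_insert_disjoint finite_insert finite_subset subsetD)
  ultimately obtain C where C: "C \<subseteq> insert x Z" "circuit E rk C"
    using circuit_exists[of "insert x Z"] Z assms by auto
  moreover have "x \<in> C"
  proof (rule ccontr)
    assume "x \<notin> C"
    then have "rk C = card C" using indep_subset[of C Z] C Z assms by blast
    then show False using C by (simp add: circuit_def)
  qed
  ultimately show ?thesis using Z by blast
qed

lemma circuit_in_closure:
  assumes "circuit E rk C" "x \<in> C" shows "rk (insert x (C - {x})) = rk (C - {x})"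
proof -
  have "rk (C - {x}) = card (C - {x})" "C \<subseteq> E" "rk C < card C"
    using assms unfolding circuit_def by blast+
  moreover have "card C = Suc (card (C - {x}))"
    using assms calculation finite_sub by (metis card.remove)
  moreover have "rk (C - {x}) \<le> rk C" using \<open>C \<subseteq> E\<close> by (intro rk_mono) auto
  ultimately have "rk C = rk (C - {x})" by linarith
  then show ?thesis using assms(2) by (simp add: insert_absorb)
qed

text \<open>A closure argument: \<open>e\<close> is in the closure of
  \<open>C1 \<union> C2 - {e, x}\<close> by \<open>C2\<close>, which avoids \<open>x\<close>, and
  \<open>x\<close> is in the closure of that set with \<open>e\<close> added by \<open>C1\<close>.
  Hence \<open>x\<close> is in the closure without \<open>e\<close>, and
  \<open>circuit_through\<close> applies.\<close>

lemma strong_circuit_elimination: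
  assumes C: "circuit E rk C1" "circuit E rk C2" and e: "e \<in> C1" "e \<in> C2" and x: "x \<in> C1" "x \<notin> C2"
  shows "\<exists>C. circuit E rk C \<and> x \<in> C \<and> C \<subseteq> C1 \<union> C2 - {e}"
proof -
  have sub: "C1 \<subseteq> E" "C2 \<subseteq> E" using C by (auto simp: circuit_def)
  define Y where "Y = C1 \<union> C2 - {e, x}"
  have 1: "rk (insert e Y) = rk Y"
    by (rule closure_mono[OF circuit_in_closure[OF C(2) e(2)]]) (use x e sub in \<open>auto simp: Y_def\<close>)
  have 2: "rk (insert x (insert e Y)) = rk (insert e Y)"
    by (rule closure_mono[OF circuit_in_closure[OF C(1) x(1)]]) (use x e sub in \<open>auto simp: Y_def\<close>)
  have "rk (insert x Y) \<le> rk (insert x (insert e Y))" "rk Y \<le> rk (insert x Y)"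
    using rk_mono[of "insert x Y" "insert x (insert e Y)"] rk_mono[of Y "insert x Y"] x e sub
    by (auto simp: Y_def)
  then have "rk (insert x Y) = rk Y" using 1 2 by simp
  then obtain C3 where "circuit E rk C3" "x \<in> C3" "C3 \<subseteq> insert x Y"
    using circuit_through[of x Y] x e sub by (auto simp: Y_def)
  moreover have "insert x Y \<subseteq> C1 \<union> C2 - {e}" using x e by (auto simp: Y_def)
  ultimately show ?thesis by blast
qed

lemma circuit_antichain: "circuit E rk C \<Longrightarrow> circuit E rk D \<Longrightarrow> \<not> C \<subset> D"
  unfolding circuit_def by (metis less_irrefl)

text \<open>Among the intersecting pairs of circuits through \<open>x\<close> and \<open>z\<close>, one with smallest union
  must consist of a single circuit: otherwise eliminating twice yields a pair with smaller union.\<close>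

lemma common_circuit_of_intersecting:
  assumes "circuit E rk C1" "circuit E rk C2" "x \<in> C1" "z \<in> C2" "C1 \<inter> C2 \<noteq> {}"
  shows "\<exists>C. circuit E rk C \<and> x \<in> C \<and> z \<in> C"
  using assms
proof (induction "card (C1 \<union> C2)" arbitrary: C1 C2 rule: less_induct)
  case less
  show ?case
  proof (cases "x \<in> C2 \<or> z \<in> C1")
    case True
    then show ?thesis using less.prems(1-4) by blast
  next
    case False
    obtain e where e: "e \<in> C1" "e \<in> C2" using less.prems(5) by blast
    obtain C3 where C3: "circuit E rk C3" "x \<in> C3" "C3 \<subseteq> C1 \<union> C2 - {e}"
      using strong_circuit_elimination[OF less.prems(1,2) e less.prems(3)] False by blast
    have "\<not> C3 \<subseteq> C1" using circuit_antichain[OF C3(1) less.prems(1)] C3 e by blast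
    then obtain f where f: "f \<in> C3" "f \<in> C2" "f \<notin> C1" using C3 by blast
    show ?thesis
    proof (cases "z \<in> C3")
      case True
      then show ?thesis using C3 by blast
    next
      case z: False
      obtain C4 where C4: "circuit E rk C4" "z \<in> C4" "C4 \<subseteq> C2 \<union> C3 - {f}"
        using strong_circuit_elimination[OF less.prems(2) C3(1) f(2,1) less.prems(4) z] by blast
      \<comment> \<open>Since \<open>C4\<close> misses \<open>f\<close>, it would otherwise be
        properly inside \<open>C2\<close>. What it has outside \<open>C2\<close> lies in
        \<open>C3\<close> and so in \<open>C1\<close>; the pair \<open>C1\<close>, \<open>C4\<close>
        therefore meets, and its union has lost \<open>f\<close>.\<close>
      have "\<not> C4 \<subseteq> C2" using circuit_antichain[OF C4(1) less.prems(2)] C4 f by blast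
      then have "C1 \<inter> C4 \<noteq> {}" using C4 C3 by blast
      moreover have "C1 \<union> C4 \<subset> C1 \<union> C2" using C3 C4 f by blast
      moreover have "finite (C1 \<union> C2)" using less.prems finite_sub by (auto simp: circuit_def)
      ultimately show ?thesis
        by (intro less.hyps[OF _ less.prems(1) C4(1) less.prems(3) C4(2)] psubset_card_mono)
    qed
  qed
qed

section \<open>Direct sums and components\<close>

text \<open>Submodularity trims one side at a time: \<open>A\<close> to \<open>X\<close> while
  \<open>B\<close> stays whole, then \<open>B\<close> to \<open>Y\<close>.\<close>

lemma rk_Un_direct_mono:
  assumes "rk (A \<union> B) = rk A + rk B" "A \<inter> B = {}" "A \<union> B \<subseteq> E" "X \<subseteq> A" "Y \<subseteq> B"
  shows "rk (X \<union> Y) = rk X + rk Y"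
proof -
  have "rk (A \<union> (X \<union> B)) + rk (A \<inter> (X \<union> B)) \<le> rk A + rk (X \<union> B)"
    using rk_submod[of A "X \<union> B"] assms by blast
  moreover have "A \<union> (X \<union> B) = A \<union> B" "A \<inter> (X \<union> B) = X" using assms by blast+
  ultimately have 1: "rk B + rk X \<le> rk (X \<union> B)" using assms by simp
  have "rk (B \<union> (X \<union> Y)) + rk (B \<inter> (X \<union> Y)) \<le> rk B + rk (X \<union> Y)"
    using rk_submod[of B "X \<union> Y"] assms by blast
  moreover have "B \<union> (X \<union> Y) = X \<union> B" "B \<inter> (X \<union> Y) = Y" using assms by blast+
  ultimately have "rk X + rk Y \<le> rk (X \<union> Y)" using 1 by simp
  moreover have "rk (X \<union> Y) \<le> rk X + rk Y" using rk_submod[of X Y] subset_trans[of _ _ E] assms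
    by (metis add_leD1 sup.boundedE)
  ultimately show ?thesis by simp
qed

lemma circuit_not_crossing:
  assumes "rk (A \<union> B) = rk A + rk B" "A \<inter> B = {}" "A \<union> B \<subseteq> E" "C \<subseteq> A \<union> B" "circuit E rk C"
  shows "C \<subseteq> A \<or> C \<subseteq> B"
proof (rule ccontr)
  assume "\<not> ?thesis"
  then have "C \<inter> A \<subset> C" "C \<inter> B \<subset> C" using assms by blast+
  then have "rk (C \<inter> A) = card (C \<inter> A)" "rk (C \<inter> B) = card (C \<inter> B)"
    using assms(5) by (auto simp: circuit_def)
  moreover have "rk (C \<inter> A \<union> C \<inter> B) = rk (C \<inter> A) + rk (C \<inter> B)"
    by (rule rk_Un_direct_mono[OF assms(1-3)]) auto
  moreover have "card (C \<inter> A \<union> C \<inter> B) = card (C \<inter> A) + card (C \<inter> B)"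
    using assms finite_sub by (intro card_Un_disjoint) (auto simp: circuit_def)
  moreover have "C \<inter> A \<union> C \<inter> B = C" using assms by blast
  ultimately show False using assms(5) by (simp add: circuit_def)
qed

text \<open>Bases of \<open>S\<close> and \<open>E - S\<close> together have more than
  \<open>rk E\<close> elements, so their union contains a circuit; each basis is independent, so the
  circuit fits into neither side.\<close>

lemma crossing_circuit:
  assumes "S \<subseteq> E" "rk S + rk (E - S) \<noteq> rk E"
  shows "\<exists>C. circuit E rk C \<and> \<not> C \<subseteq> S \<and> \<not> C \<subseteq> E - S"
proof -
  obtain A where A: "A \<subseteq> S" "rk A = card A" "rk A = rk S" using basis_of assms by blast
  obtain B where B: "B \<subseteq> E - S" "rk B = card B" "rk B = rk (E - S)" using basis_of[of "E - S"] by blast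
  have "rk E \<le> rk S + rk (E - S)" using rk_submod[of S "E - S"] assms by (simp add: Un_absorb1)
  then have "rk E < card A + card B" using A B assms by simp
  moreover have "card (A \<union> B) = card A + card B"
    using A B assms finite_sub[of A] finite_sub[of B] by (intro card_Un_disjoint) auto
  moreover have "rk (A \<union> B) \<le> rk E" using A(1) B(1) assms(1) by (intro rk_mono) auto
  ultimately obtain C where C: "C \<subseteq> A \<union> B" "circuit E rk C"
    using circuit_exists[of "A \<union> B"] A B assms by auto
  have dep: "rk C \<noteq> card C" using C(2) by (simp add: circuit_def)
  have "\<not> C \<subseteq> S"
  proof
    assume "C \<subseteq> S"
    then have "C \<subseteq> A" using B(1) C(1) by blast
    then show False using indep_subset[of C A] dep A assms(1) by auto
  qed
  moreover have "\<not> C \<subseteq> E - S"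
  proof
    assume "C \<subseteq> E - S"
    then have "C \<subseteq> B" using A(1) C(1) by blast
    then show False using indep_subset[of C B] dep B by auto
  qed
  ultimately show ?thesis using C by blast
qed

text \<open>This turns components, defined through common circuits, into direct summands. If the
  ranks did not add up, some circuit would leave \<open>S\<close> through a point \<open>z\<close>;
  by \<open>common_circuit_of_intersecting\<close> every point of \<open>S\<close> would share a
  circuit with \<open>z\<close>, against maximality.\<close>

lemma component_separator:
  assumes "component E rk S" "E \<noteq> {}"
  shows "S \<noteq> {}" "S \<subseteq> E" "rk E = rk S + rk (E - S)"
proof -
  define P where "P = (\<lambda>S. S \<subseteq> E \<and> (\<forall>x\<in>S. \<forall>y\<in>S. x \<noteq> y \<longrightarrow> (\<exists>C. circuit E rk C \<and> x \<in> C \<and> y \<in> C)))"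
  have S: "P S" "\<And>S'. P S' \<Longrightarrow> S \<subseteq> S' \<Longrightarrow> S' = S"
    using assms(1) unfolding component_def P_def Let_def by blast+
  show "S \<subseteq> E" using S(1) by (simp add: P_def)
  show "S \<noteq> {}"
  proof
    assume "S = {}"
    moreover obtain x where "x \<in> E" using assms by blast
    ultimately show False using S(2)[of "{x}"] by (auto simp: P_def)
  qed
  show "rk E = rk S + rk (E - S)"
  proof (rule ccontr)
    assume "\<not> ?thesis"
    then obtain C where C: "circuit E rk C" "\<not> C \<subseteq> S" "\<not> C \<subseteq> E - S"
      using crossing_circuit[of S] \<open>S \<subseteq> E\<close> by metis
    then obtain y z where y: "y \<in> C" "y \<in> S" and z: "z \<in> C" "z \<notin> S"
      using \<open>circuit E rk C\<close> by (auto simp: circuit_def)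
    have "\<exists>D. circuit E rk D \<and> x \<in> D \<and> z \<in> D" if x: "x \<in> S" for x
    proof (cases "x = y")
      case True
      then show ?thesis using C y z by blast
    next
      case False
      then obtain C' where "circuit E rk C'" "x \<in> C'" "y \<in> C'" using S(1) y x unfolding P_def by blast
      then show ?thesis using common_circuit_of_intersecting[of C' C x z] C y z by blast
    qed
    moreover have "z \<in> E" using C(1) z(1) by (auto simp: circuit_def)
    ultimately have "P (insert z S)" using S(1) unfolding P_def by blast
    then show False using S(2) z by blast
  qed
qed

lemma matroid_rank_subset: "F \<subseteq> E \<Longrightarrow> matroid_rank F rk"
  by unfold_locales (auto intro: finite_sub rk_le_card rk_mono rk_submod)

lemma matroid_rank_contract:
  assumes "e \<in> E" shows "matroid_rank (E - {e}) (contract_rk rk e)"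
proof
  have le: "rk {e} \<le> rk (insert e X)" if "X \<subseteq> E" for X
    using rk_mono[of "{e}" "insert e X"] that assms by auto
  show "finite (E - {e})" using finite_ground by simp
  fix X assume X: "X \<subseteq> E - {e}"
  show "contract_rk rk e X \<le> card X"
  proof -
    have "X \<subseteq> E" using X by blast
    then show ?thesis using rk_submod[of X "{e}"] assms rk_le_card[of X] by (simp add: contract_rk_def)
  qed
  fix Y
  { assume "Y \<subseteq> E - {e}"
    with X have "rk (insert e (X \<union> Y)) + rk (insert e (X \<inter> Y)) \<le> rk (insert e X) + rk (insert e Y)"
      using rk_submod[of "insert e X" "insert e Y"] assms by auto
    moreover have "X \<union> Y \<subseteq> E" "X \<inter> Y \<subseteq> E" "X \<subseteq> E" "Y \<subseteq> E" using X \<open>Y \<subseteq> E - {e}\<close> by auto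
    ultimately show "contract_rk rk e (X \<union> Y) + contract_rk rk e (X \<inter> Y) \<le> contract_rk rk e X + contract_rk rk e Y"
      using le[of "X \<union> Y"] le[of "X \<inter> Y"] le[of X] le[of Y] by (simp add: contract_rk_def)
  }
next
  fix X Y assume "X \<subseteq> Y" "Y \<subseteq> E - {e}"
  then have "insert e X \<subseteq> insert e Y" "insert e Y \<subseteq> E" using assms by auto
  then show "contract_rk rk e X \<le> contract_rk rk e Y"
    using rk_mono[of "insert e X" "insert e Y"] by (simp add: contract_rk_def)
qed

end

text \<open>The recursion for the contraction-deletion-depth with the connectivity side conditions
  dropped; it yields upper bounds.\<close>

inductive cdd_bound :: "'a set \<Rightarrow> ('a set \<Rightarrow> nat) \<Rightarrow> nat \<Rightarrow> bool" where
  single: "card E = 1 \<Longrightarrow> 1 \<le> k \<Longrightarrow> cdd_bound E rk k"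
| sum: "A \<noteq> {} \<Longrightarrow> B \<noteq> {} \<Longrightarrow> A \<inter> B = {} \<Longrightarrow> rk (A \<union> B) = rk A + rk B \<Longrightarrow>
     cdd_bound A rk k \<Longrightarrow> cdd_bound B rk k \<Longrightarrow> cdd_bound (A \<union> B) rk k"
| contract: "e \<in> E \<Longrightarrow> cdd_bound (E - {e}) (contract_rk rk e) k \<Longrightarrow> cdd_bound E rk (Suc k)"
| delete: "e \<in> E \<Longrightarrow> cdd_bound (E - {e}) rk k \<Longrightarrow> cdd_bound E rk (Suc k)"

lemma cdd_bound_nonempty: "cdd_bound E rk k \<Longrightarrow> E \<noteq> {}"
  by (induction rule: cdd_bound.induct) auto

lemma cdd_bound_pos: "cdd_bound E rk k \<Longrightarrow> 1 \<le> k"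
  by (induction rule: cdd_bound.induct) auto

lemma cdd_bound_mono: "cdd_bound E rk k \<Longrightarrow> k \<le> l \<Longrightarrow> cdd_bound E rk l"
proof (induction arbitrary: l rule: cdd_bound.induct)
  case (single E k rk)
  then show ?case by (intro cdd_bound.single) simp_all
next
  case (sum A B rk k)
  then show ?case by (intro cdd_bound.sum) simp_all
next
  case (contract e E rk k)
  then obtain l' where l: "l = Suc l'" "k \<le> l'" by (cases l) auto
  show ?case unfolding l by (rule cdd_bound.contract[OF contract.hyps(1) contract.IH[OF l(2)]])
next
  case (delete e E rk k)
  then obtain l' where l: "l = Suc l'" "k \<le> l'" by (cases l) auto
  show ?case unfolding l by (rule cdd_bound.delete[OF delete.hyps(1) delete.IH[OF l(2)]])
qed

lemma cdd_bound_cong: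
  "cdd_bound E rk k \<Longrightarrow> (\<And>X. X \<subseteq> E \<Longrightarrow> rk' X = rk X) \<Longrightarrow> cdd_bound E rk' k"
proof (induction arbitrary: rk' rule: cdd_bound.induct)
  case (single E k rk)
  then show ?case by (intro cdd_bound.single)
next
  case (sum A B rk k)
  have "cdd_bound A rk' k" "cdd_bound B rk' k"
    by (rule sum.IH, simp add: sum.prems le_supI1 le_supI2)+
  then show ?case
    using sum.hyps sum.prems[of A] sum.prems[of B] sum.prems[of "A \<union> B"]
    by (intro cdd_bound.sum) auto
next
  case (contract e E rk k)
  have "cdd_bound (E - {e}) (contract_rk rk' e) k"
  proof (rule contract.IH)
    fix X assume "X \<subseteq> E - {e}"
    then have "X \<union> {e} \<subseteq> E" "{e} \<subseteq> E" using contract.hyps by auto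
    then show "contract_rk rk' e X = contract_rk rk e X"
      unfolding contract_rk_def by (simp only: contract.prems)
  qed
  then show ?case by (rule cdd_bound.contract[OF contract.hyps(1)])
next
  case (delete e E rk k)
  have "cdd_bound (E - {e}) rk' k" 
    by (rule delete.IH) (use delete.prems in auto)
  then show ?case by (rule cdd_bound.delete[OF delete.hyps(1)])
qed

text \<open>A derivation of \<open>cdd_bound\<close> may split the matroid along other sums than its
  components, so the bound has to pass to every direct summand. In the sum case the two splittings
  are intersected; removing an element outside \<open>X\<close> does not affect \<open>X\<close> and
  merely wastes one unit of the bound.\<close>

lemma cdd_bound_summand:
  "cdd_bound E rk k \<Longrightarrow> matroid_rank E rk \<Longrightarrow> E = X \<union> Y \<Longrightarrow> X \<inter> Y = {} \<Longrightarrow>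
    rk E = rk X + rk Y \<Longrightarrow> X \<noteq> {} \<Longrightarrow> cdd_bound X rk k"
proof (induction arbitrary: X Y rule: cdd_bound.induct)
  case (single E k rk)
  then have "X = E" by (metis card_1_singletonE subset_singletonD Un_upper1)
  then show ?case using single.hyps by (simp add: cdd_bound.single)
next
  case (sum A B rk k)
  interpret matroid_rank "A \<union> B" rk by (rule sum.prems)
  note split = rk_Un_direct_mono[OF sum.hyps(4,3) subset_refl]
  note split' = rk_Un_direct_mono[of X Y, OF _ sum.prems(3)]
  have A: "cdd_bound (X \<inter> A) rk k" if "X \<inter> A \<noteq> {}"
  proof (rule sum.IH(1))
    show "matroid_rank A rk" by (rule matroid_rank_subset) auto
    show "A = (X \<inter> A) \<union> (Y \<inter> A)" using sum.prems by blast
    then show "rk A = rk (X \<inter> A) + rk (Y \<inter> A)"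
      using split'[of "X \<inter> A" "Y \<inter> A"] sum.prems by simp
  qed (use sum.prems that in auto)
  have B: "cdd_bound (X \<inter> B) rk k" if "X \<inter> B \<noteq> {}"
  proof (rule sum.IH(2))
    show "matroid_rank B rk" by (rule matroid_rank_subset) auto
    show "B = (X \<inter> B) \<union> (Y \<inter> B)" using sum.prems by blast
    then show "rk B = rk (X \<inter> B) + rk (Y \<inter> B)"
      using split'[of "X \<inter> B" "Y \<inter> B"] sum.prems by simp
  qed (use sum.prems that in auto)
  have X: "X = X \<inter> A \<union> X \<inter> B" using sum.prems by blast
  consider "X \<inter> A = {}" | "X \<inter> B = {}" | "X \<inter> A \<noteq> {}" "X \<inter> B \<noteq> {}" by blast
  then show ?case
  proof cases
    case 3
    have "cdd_bound (X \<inter> A \<union> X \<inter> B) rk k"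
      by (rule cdd_bound.sum) (use 3 A B sum.hyps split[of "X \<inter> A" "X \<inter> B"] in auto)
    then show ?thesis using X by simp
  qed (use X A B sum.prems in auto)
next
  case (contract e E rk k)
  interpret matroid_rank E rk by (rule contract.prems)
  interpret c: matroid_rank "E - {e}" "contract_rk rk e" by (rule matroid_rank_contract) (rule contract)
  have dir: "rk (Z \<union> Z') = rk Z + rk Z'" if "Z \<subseteq> X" "Z' \<subseteq> Y" for Z Z'
    using rk_Un_direct_mono[of X Y Z Z'] contract.prems that by simp
  show ?case
  proof (cases "e \<in> X")
    case True
    show ?thesis
    proof (cases "X = {e}")
      case True
      then show ?thesis by (simp add: cdd_bound.single)
    next
      case False
      have Y: "rk (insert e Y) = rk {e} + rk Y" using dir[of "{e}" Y] True by simp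
      have "rk {e} \<le> rk X" using rk_mono[of "{e}" X] True contract.prems by auto
      moreover have "insert e (E - {e}) = E" "insert e (X - {e}) = X" using True contract.hyps by auto
      ultimately have "contract_rk rk e (E - {e}) = contract_rk rk e (X - {e}) + contract_rk rk e Y"
        using contract.prems(4) Y by (simp add: contract_rk_def)
      then have "cdd_bound (X - {e}) (contract_rk rk e) k"
        using contract.prems True False c.matroid_rank_axioms
        by (intro contract.IH[of "X - {e}" Y]) auto
      then show ?thesis by (rule cdd_bound.contract[OF True])
    qed
  next
    case False
    then have "e \<in> Y" using contract by auto
    \<comment> \<open>Here \<open>e\<close> lies in the other summand, so its contraction changes no
      rank within \<open>X\<close>.\<close>
    then have Z: "contract_rk rk e Z = rk Z" if "Z \<subseteq> X" for Z
      using dir[of Z "{e}"] that by (simp add: contract_rk_def)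
    have "rk {e} \<le> rk Y" using rk_mono[of "{e}" Y] \<open>e \<in> Y\<close> contract.prems by auto
    moreover have "insert e (E - {e}) = E" "insert e (Y - {e}) = Y" using \<open>e \<in> Y\<close> contract.hyps by auto
    ultimately have "contract_rk rk e (E - {e}) = contract_rk rk e X + contract_rk rk e (Y - {e})"
      using contract.prems(4) Z[of X] by (simp add: contract_rk_def)
    then have "cdd_bound X (contract_rk rk e) k"
      using contract.prems \<open>e \<in> Y\<close> False c.matroid_rank_axioms
      by (intro contract.IH[of X "Y - {e}"]) auto
    then have "cdd_bound X rk k" by (rule cdd_bound_cong) (simp add: Z)
    then show ?thesis by (rule cdd_bound_mono) simp
  qed
next
  case (delete e E rk k)
  interpret matroid_rank E rk by (rule delete.prems)
  have m: "matroid_rank (E - {e}) rk" by (rule matroid_rank_subset) auto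
  have dir: "rk (Z \<union> Z') = rk Z + rk Z'" if "Z \<subseteq> X" "Z' \<subseteq> Y" for Z Z'
    using rk_Un_direct_mono[of X Y Z Z'] delete.prems that by simp
  have E: "E - {e} = (X - {e}) \<union> (Y - {e})" using delete.prems by blast
  show ?case
  proof (cases "X = {e}")
    case True
    then show ?thesis by (simp add: cdd_bound.single)
  next
    case False
    then have X: "cdd_bound (X - {e}) rk k"
      using delete.prems m E dir[of "X - {e}" "Y - {e}"]
      by (intro delete.IH[of "X - {e}" "Y - {e}"]) auto
    show ?thesis
    proof (cases "e \<in> X")
      case True
      then show ?thesis using X by (rule cdd_bound.delete)
    next
      case False
      then show ?thesis using cdd_bound_mono[OF X, of "Suc k"] by simp
    qed
  qed
qed

text \<open>\<open>cdd_le\<close> selects its rule by connectivity, so the induction is on the size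
  of the ground set and not on the derivation. For a disconnected matroid the last rule is ignored
  and each component inherits the bound as a summand. For a connected one the last rule cannot be a
  sum, because a common circuit of points from both sides would cross it.\<close>

lemma cdd_bound_imp_cdd_le: "cdd_bound E rk k \<Longrightarrow> matroid_rank E rk \<Longrightarrow> cdd_le E rk k"
proof (induction "card E" arbitrary: E rk k rule: less_induct)
  case less
  interpret matroid_rank E rk by (rule less.prems)
  have ne: "E \<noteq> {}" using cdd_bound_nonempty less.prems by blast
  show ?case
  proof (cases "card E = 1")
    case True
    then show ?thesis using cdd_bound_pos[OF less.prems(1)] by (rule cdd_le.single)
  next
    case False
    show ?thesis
    proof (cases "connected_matroid E rk")
      case disc: False
      show ?thesis
      proof (rule cdd_le.disconnected[OF False disc], intro allI impI)
        fix S assume S: "component E rk S"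
        note sep = component_separator[OF S ne]
        have "S \<noteq> E" using S disc by (auto simp: connected_matroid_def)
        then have "card S < card E" using sep finite_ground by (simp add: psubset_card_mono psubsetI)
        moreover have "cdd_bound S rk k"
          using cdd_bound_summand[OF less.prems, of S "E - S"] sep by auto
        ultimately show "cdd_le S rk k" using less.hyps matroid_rank_subset sep by blast
      qed
    next
      case conn: True
      have card: "card (E - {e}) < card E" if "e \<in> E" for e
        using that finite_ground by (rule card_Diff1_less[rotated])
      from less.prems(1) show ?thesis
      proof cases
        case (sum A B)
        then obtain x y where xy: "x \<in> A" "y \<in> B" by blast
        then have "x \<noteq> y" using sum by blast
        then obtain C where C: "circuit E rk C" "x \<in> C" "y \<in> C"
          using conn xy sum unfolding connected_matroid_def component_def Let_def by blast
        then have "C \<subseteq> A \<or> C \<subseteq> B"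
          using circuit_not_crossing[of A B C] sum by (auto simp: circuit_def)
        then show ?thesis using C xy sum by blast
      next
        case (contract e k')
        then show ?thesis
          using less.hyps[OF card] matroid_rank_contract cdd_le.contract[OF False conn] by blast
      next
        case (delete e k')
        then show ?thesis
          using less.hyps[OF card] matroid_rank_subset[of "E - {e}"] cdd_le.delete[OF False conn] by blast
      qed (use False in simp)
    qed
  qed
qed

lemma cdd_bound_delete_set:
  assumes "finite D" "D \<inter> E = {}" "cdd_bound E rk k"
  shows "cdd_bound (E \<union> D) rk (k + card D)"
  using assms
proof (induction D rule: finite_induct)
  case (insert x D)
  then have "E \<union> insert x D - {x} = E \<union> D" by blast
  then show ?case using insert cdd_bound.delete[of x "E \<union> insert x D" rk "k + card D"] by simp
qed simp

text \<open>The rank function varies in the induction: removing \<open>x\<close> first replaces it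
  by \<open>contract_rk rk x\<close>, relative to which contracting \<open>C\<close> gives the same
  ranks as contracting \<open>insert x C\<close> from \<open>rk\<close>.\<close>

lemma cdd_bound_contract_set:
  assumes "finite C" "C \<inter> E = {}" "matroid_rank (E \<union> C) rk"
    and "cdd_bound E (\<lambda>X. rk (X \<union> C) - rk C) k"
  shows "cdd_bound (E \<union> C) rk (k + card C)"
  using assms
proof (induction C arbitrary: rk rule: finite_induct)
  case empty
  have "rk {} = 0" using empty by (simp add: matroid_rank.rk_empty)
  then show ?case using empty by simp
next
  case (insert x C)
  interpret matroid_rank "E \<union> insert x C" rk by (rule insert.prems)
  have E: "E \<union> insert x C - {x} = E \<union> C" using insert by blast
  have "cdd_bound (E \<union> C) (contract_rk rk x) (k + card C)"
  proof (rule insert.IH)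
    show "matroid_rank (E \<union> C) (contract_rk rk x)" using matroid_rank_contract[of x] E by simp
    show "cdd_bound E (\<lambda>X. contract_rk rk x (X \<union> C) - contract_rk rk x C) k"
    proof (rule cdd_bound_cong[OF insert.prems(3)])
      fix X assume "X \<subseteq> E"
      then have "rk {x} \<le> rk (insert x C)" "rk (insert x C) \<le> rk (insert x (X \<union> C))"
        using rk_mono[of "{x}" "insert x C"] rk_mono[of "insert x C" "insert x (X \<union> C)"] by auto
      then show "contract_rk rk x (X \<union> C) - contract_rk rk x C = rk (X \<union> insert x C) - rk (insert x C)"
        by (simp add: contract_rk_def)
    qed
  qed (use insert in auto)
  then show ?case using cdd_bound.contract[of x "E \<union> insert x C" rk] E insert by simp
qed

section \<open>Dimensions of finitely generated subspaces\<close>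

context vector_space
begin

text \<open>The ambient space of all functions on the naturals is infinite-dimensional, and
  \<open>dim\<close> is 0 on sets without a finite basis, so dimension laws need an explicit
  finiteness condition.\<close>

definition fin_dim :: "'b set \<Rightarrow> bool" where
  "fin_dim S \<longleftrightarrow> (\<exists>B. finite B \<and> S \<subseteq> span B)"

lemma fin_dim_finite: "finite S \<Longrightarrow> fin_dim S"
  using span_superset unfolding fin_dim_def by blast

lemma fin_dim_subset: "fin_dim T \<Longrightarrow> S \<subseteq> span T \<Longrightarrow> fin_dim S"
  unfolding fin_dim_def by (meson span_minimal subset_trans subspace_span)

lemma fin_dim_span: "fin_dim S \<Longrightarrow> fin_dim (span S)"
  by (rule fin_dim_subset) auto

lemma fin_dim_Un:
  assumes "fin_dim S" "fin_dim T" shows "fin_dim (S \<union> T)"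
proof -
  obtain A B where "finite A" "S \<subseteq> span A" "finite B" "T \<subseteq> span B"
    using assms unfolding fin_dim_def by blast
  then have "finite (A \<union> B)" "S \<union> T \<subseteq> span (A \<union> B)"
    using span_mono[of A "A \<union> B"] span_mono[of B "A \<union> B"] by auto
  then show ?thesis unfolding fin_dim_def by blast
qed

lemma fin_dim_UN: "finite I \<Longrightarrow> (\<And>i. i \<in> I \<Longrightarrow> fin_dim (S i)) \<Longrightarrow> fin_dim (\<Union>i\<in>I. S i)"
  by (induction rule: finite_induct) (simp_all add: fin_dim_finite fin_dim_Un)

lemma finite_basis_exists:
  assumes "fin_dim S"
  obtains B where "B \<subseteq> S" "finite B" "independent B" "S \<subseteq> span B" "card B = dim S"
proof -
  obtain A where A: "finite A" "S \<subseteq> span A" using assms unfolding fin_dim_def by blast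
  obtain B where B: "B \<subseteq> S" "independent B" "S \<subseteq> span B" "card B = dim S" by (rule basis_exists)
  have "finite B" using independent_span_bound[OF A(1) B(2)] A(2) B(1) by blast
  then show thesis using that B by blast
qed

lemma dim_mono_fin_dim: 
  assumes "fin_dim T" "S \<subseteq> span T" shows "dim S \<le> dim T"
proof -
  obtain B where B: "finite B" "T \<subseteq> span B" "card B = dim T" using finite_basis_exists[OF assms(1)] by metis
  have "S \<subseteq> span B" using assms(2) span_minimal[OF B(2)] by auto
  then show ?thesis using dim_le_card[OF _ B(1)] B(3) by simp
qed

lemma span_Int_span_independent:
  assumes "independent (A \<union> B)" "A \<inter> B = {}"
  shows "span A \<inter> span B = {0}"
proof -
  have zero: "x = 0" if "finite t" "t \<subseteq> A" "x \<in> span t" "x \<in> span B" for t x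
    using that
  proof (induction t arbitrary: x rule: finite_induct)
    case empty
    then show ?case by simp
  next
    case (insert a t)
    then obtain k where k: "x - scale k a \<in> span t" by (auto simp: span_insert)
    have "k = 0"
    proof (rule ccontr)
      assume "k \<noteq> 0"
      have "x - scale k a \<in> span (t \<union> B)" "x \<in> span (t \<union> B)"
        using k insert.prems span_mono[of t "t \<union> B"] span_mono[of B "t \<union> B"] by auto
      then have "x - (x - scale k a) \<in> span (t \<union> B)" by (metis span_diff)
      then have "scale (1 / k) (scale k a) \<in> span (t \<union> B)" by (metis span_scale diff_diff_eq2 add_diff_cancel_left')
      then have "a \<in> span (t \<union> B)" using \<open>k \<noteq> 0\<close> by simp
      moreover have "t \<union> B \<subseteq> A \<union> B - {a}" using insert assms(2) by auto
      ultimately have "a \<in> span (A \<union> B - {a})" using span_mono by blast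
      then show False using assms(1) insert.prems unfolding dependent_def by blast
    qed
    then show ?case using k insert by simp
  qed
  have "\<exists>t. finite t \<and> t \<subseteq> A \<and> x \<in> span t" if "x \<in> span A" for x
  proof -
    obtain t r where "finite t" "t \<subseteq> A" "x = (\<Sum>a\<in>t. scale (r a) a)"
      using \<open>x \<in> span A\<close> unfolding span_explicit by blast
    moreover have "(\<Sum>a\<in>t. scale (r a) a) \<in> span t" by (intro span_sum span_scale span_base)
    ultimately show ?thesis by blast
  qed
  then have "x = 0" if "x \<in> span A" "x \<in> span B" for x using zero that by metis
  then show ?thesis by (auto simp: span_zero)
qed

lemma independent_Un:
  assumes "finite A" "independent A" "independent B" "span A \<inter> span B = {0}"
  shows "independent (A \<union> B)"
  using assms
proof (induction A rule: finite_induct)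
  case empty
  then show ?case by simp
next
  case (insert a A)
  have a: "a \<notin> span A" "independent A" using insert by (simp_all add: independent_insert)
  have A: "span A \<subseteq> span (insert a A)" by (rule span_mono) auto
  then have ind: "independent (A \<union> B)" using insert a span_zero by blast
  have "a \<notin> span (A \<union> B)"
  proof
    assume "a \<in> span (A \<union> B)"
    then obtain x y where xy: "a = x + y" "x \<in> span A" "y \<in> span B" unfolding span_Un by blast
    have "a - x \<in> span (insert a A)" by (rule span_diff) (use xy(2) A in \<open>auto intro: span_base\<close>)
    then have "y \<in> span (insert a A)" by (simp add: xy(1))
    then have "y = 0" using xy insert.prems by blast
    then show False using xy a by simp
  qed
  then show ?case using ind by (simp add: independent_insertI)
qed

lemma dim_zero [simp]: "dim {0} = 0"
  using dim_eq_card[of "{}" "{0}"] by (simp add: independent_empty)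

text \<open>The modular law; since \<open>dim\<close> looks only at the span, a union stands for the
  sum of subspaces here and below. The vectors \<open>C\<close> that extend a basis of the
  intersection to one of \<open>S\<close> are independent of \<open>T\<close>, so adding a basis of
  \<open>T\<close> to them gives a basis of the sum.\<close>

lemma dim_Un_Int:
  assumes "subspace S" "subspace T" "fin_dim S" "fin_dim T"
  shows "dim (S \<union> T) + dim (S \<inter> T) = dim S + dim T"
proof -
  have "fin_dim (S \<inter> T)" by (rule fin_dim_subset[OF assms(3)]) (auto intro: span_base)
  then obtain B where B: "B \<subseteq> S \<inter> T" "finite B" "independent B" "S \<inter> T \<subseteq> span B" "card B = dim (S \<inter> T)"
    by (rule finite_basis_exists)
  obtain B' where B': "B \<subseteq> B'" "B' \<subseteq> S" "independent B'" "S \<subseteq> span B'"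
    using maximal_independent_subset_extend[of B S] B by blast
  obtain F where F: "finite F" "S \<subseteq> span F" using assms(3) unfolding fin_dim_def by blast
  have "B' \<subseteq> span F" using B'(2) F(2) by (rule subset_trans)
  then have fB': "finite B'" using independent_span_bound[OF F(1) B'(3)] by simp
  define C where "C = B' - B"
  have C: "B \<union> C = B'" "B \<inter> C = {}" "C \<subseteq> S" using B' by (auto simp: C_def)
  have spC: "span C \<subseteq> S" by (rule span_minimal[OF C(3) assms(1)])
  have spBC: "span B \<inter> span C = {0}" using span_Int_span_independent[of B C] B'(3) C by simp
  obtain D where D: "D \<subseteq> T" "finite D" "independent D" "T \<subseteq> span D" "card D = dim T"
    by (rule finite_basis_exists[OF assms(4)])
  have spD: "span D \<subseteq> T" by (rule span_minimal[OF D(1) assms(2)])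
  have "span C \<inter> span D \<subseteq> span B \<inter> span C" using spC spD B(4) by blast
  then have CD: "span C \<inter> span D = {0}" using spBC by (auto simp: span_zero)
  have fC: "finite C" using fB' by (simp add: C_def)
  have "independent C" using B'(3) by (rule independent_mono) (simp add: C_def)
  then have iCD: "independent (C \<union> D)" using independent_Un[OF fC _ D(3) CD] by simp
  have "C \<inter> D = {}"
  proof -
    have "C \<inter> D \<subseteq> span C \<inter> span D" by (auto intro: span_base)
    then have "C \<inter> D \<subseteq> {0}" unfolding CD .
    moreover have "0 \<notin> D" using D(3) dependent_zero by blast
    ultimately show ?thesis by blast
  qed
  then have cCD: "card (C \<union> D) = card C + card D" using fC D(2) by (simp add: card_Un_disjoint)
  have "B \<subseteq> span (C \<union> D)" using B(1) D(4) span_mono[of D "C \<union> D"] by blast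
  then have "B' \<subseteq> span (C \<union> D)" using C span_superset[of "C \<union> D"] by blast
  then have "S \<subseteq> span (C \<union> D)" using B'(4) span_minimal[of B' "span (C \<union> D)"] by blast
  moreover have "T \<subseteq> span (C \<union> D)" using D(4) span_mono[of D "C \<union> D"] by blast
  ultimately have "dim (S \<union> T) = card (C \<union> D)"
    using dim_unique[of "C \<union> D" "S \<union> T"] C(3) D(1) iCD by blast
  moreover have "dim S = card B'" using dim_unique[of B' S] B' by simp
  moreover have "card B' = card B + card C" using C B(2) fC by (metis card_Un_disjoint)
  ultimately show ?thesis using cCD D(5) B(5) by simp
qed

lemma dim_Un_span: "dim (span S \<union> span T) = dim (S \<union> T)"
  using span_superset span_mono[of S "S \<union> T"] span_mono[of T "S \<union> T"]
  by (intro span_eq_dim) (auto simp: span_eq intro: span_base)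

lemma dim_Un_span_left: "dim (span S \<union> T) = dim (S \<union> T)"
  using span_superset span_mono[of S "S \<union> T"]
  by (intro span_eq_dim) (auto simp: span_eq intro: span_base)

lemma dim_Un_span_Int:
  assumes "fin_dim S" "fin_dim T"
  shows "dim (S \<union> T) + dim (span S \<inter> span T) = dim S + dim T"
  using dim_Un_Int[of "span S" "span T"] assms by (simp add: dim_Un_span fin_dim_span)

lemma dim_Un_direct:
  assumes "fin_dim S" "fin_dim T" "span S \<inter> span T = {0}"
  shows "dim (S \<union> T) = dim S + dim T"
  using dim_Un_span_Int[OF assms(1,2)] assms(3) by simp

lemma matroid_rank_dim:
  assumes "finite E" shows "matroid_rank E (\<lambda>X. dim (v ` X))"
proof
  fix X Y
  show "dim (v ` X) \<le> card X" if "X \<subseteq> E"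
  proof -
    have "finite X" using assms that by (rule finite_subset[rotated])
    then show ?thesis using dim_le_card'[of "v ` X"] card_image_le[of X v] by simp
  qed
  show "dim (v ` X) \<le> dim (v ` Y)" if "X \<subseteq> Y" "Y \<subseteq> E"
  proof (rule dim_mono_fin_dim)
    show "fin_dim (v ` Y)" using assms that by (meson fin_dim_finite finite_imageI finite_subset)
    show "v ` X \<subseteq> span (v ` Y)" using that span_superset by blast
  qed
  show "dim (v ` (X \<union> Y)) + dim (v ` (X \<inter> Y)) \<le> dim (v ` X) + dim (v ` Y)" if "X \<subseteq> E" "Y \<subseteq> E"
  proof -
    have f: "fin_dim (v ` X)" "fin_dim (v ` Y)"
      using assms that by (meson fin_dim_finite finite_imageI finite_subset)+
    have "fin_dim (span (v ` X) \<inter> span (v ` Y))" by (rule fin_dim_subset[OF f(1)]) auto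
    then have "dim (v ` (X \<inter> Y)) \<le> dim (span (v ` X) \<inter> span (v ` Y))"
      by (rule dim_mono_fin_dim) (auto intro!: span_base)
    then show ?thesis using dim_Un_span_Int[OF f] by (simp add: image_Un)
  qed
qed (rule assms)

section \<open>Changing vectors modulo a subspace\<close>

lemma span_Un_perturb:
  assumes "\<And>x. x \<in> X \<Longrightarrow> v x - v' x \<in> span U"
  shows "span (v ` X \<union> U) = span (v' ` X \<union> U)"
proof -
  have U: "span U \<subseteq> span (w ` X \<union> U)" for w :: "_ \<Rightarrow> 'b" by (rule span_mono) auto
  have "v x \<in> span (v' ` X \<union> U)" if "x \<in> X" for x
  proof -
    have "v' x + (v x - v' x) \<in> span (v' ` X \<union> U)"
      using that assms U[of v'] by (intro span_add) (auto intro: span_base)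
    then show ?thesis by simp
  qed
  moreover have "v' x \<in> span (v ` X \<union> U)" if "x \<in> X" for x
  proof -
    have "v x - (v x - v' x) \<in> span (v ` X \<union> U)"
      by (rule span_diff) (use that assms U[of v] in \<open>auto intro: span_base\<close>)
    then show ?thesis by simp
  qed
  ultimately show ?thesis by (auto simp: span_eq intro: span_base)
qed

text \<open>The dimension form of contraction: \<open>v\<close> and \<open>v'\<close> agree modulo
  \<open>U\<close>, and \<open>v'\<close> meets \<open>U\<close> trivially, so \<open>v'\<close>
  represents \<open>v\<close> with \<open>U\<close> contracted.\<close>

lemma dim_Un_perturb:
  assumes "finite X" "fin_dim U" "\<And>x. x \<in> X \<Longrightarrow> v x - v' x \<in> span U"
    and "span (v' ` X) \<inter> span U = {0}"
  shows "dim (v ` X \<union> U) = dim (v' ` X) + dim U"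
  using span_Un_perturb[of X v v' U] assms(3) dim_Un_direct[OF _ assms(2,4)] assms(1)
  by (metis dim_span fin_dim_finite finite_imageI)

lemma complement_exists:
  assumes "subspace U" "subspace V" "U \<subseteq> V"
  shows "\<exists>C. subspace C \<and> C \<subseteq> V \<and> C \<inter> U = {0} \<and> (\<forall>x\<in>V. \<exists>c\<in>C. x - c \<in> U)"
proof -
  obtain B where B: "B \<subseteq> U" "independent B" "U \<subseteq> span B" by (rule maximal_independent_subset)
  obtain B' where B': "B \<subseteq> B'" "B' \<subseteq> V" "independent B'" "V \<subseteq> span B'"
    using maximal_independent_subset_extend[of B V] B assms(3) by blast
  have U: "span B = U" using span_minimal[OF B(1) assms(1)] B(3) by blast
  have split: "(B' - B) \<union> B = B'" using B'(1) by blast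
  have "span (B' - B) \<inter> U = {0}"
    using span_Int_span_independent[of "B' - B" B] B'(3) U split by auto
  moreover have "span (B' - B) \<subseteq> V" using B'(2) by (intro span_minimal assms(2)) auto
  moreover have "\<exists>c\<in>span (B' - B). x - c \<in> U" if "x \<in> V" for x
  proof -
    have "x \<in> span ((B' - B) \<union> B)" using that B'(4) split by auto
    then obtain c u where "x = c + u" "c \<in> span (B' - B)" "u \<in> U" unfolding span_Un U by blast
    then show ?thesis by (intro bexI[of _ c]) auto
  qed
  ultimately show ?thesis by (intro exI[of _ "span (B' - B)"]) auto
qed

text \<open>Passing from \<open>v\<close> to \<open>v'\<close> contracts \<open>U\<close>: no rank
  rises, and the rank of \<open>X \<union> Y\<close> falls by at most \<open>dim U\<close>. Only
  this last, subtracted term can increase the connectivity, so \<open>dim U\<close> is paid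
  once.\<close>

lemma lam_perturb_le:
  assumes "finite X" "finite Y" "fin_dim U"
    and "\<And>x. x \<in> X \<union> Y \<Longrightarrow> v x - v' x \<in> span U"
    and "span (v' ` (X \<union> Y)) \<inter> span U = {0}"
  shows "lam (\<lambda>Z. dim (v' ` Z)) X Y \<le> lam (\<lambda>Z. dim (v ` Z)) X Y + dim U"
proof -
  have eq: "dim (v ` Z \<union> U) = dim (v' ` Z) + dim U" if "Z \<subseteq> X \<union> Y" for Z
  proof (rule dim_Un_perturb)
    show "finite Z" using assms(1,2) that by (meson finite_UnI finite_subset)
    have "span (v' ` Z) \<subseteq> span (v' ` (X \<union> Y))" using that by (intro span_mono image_mono)
    then show "span (v' ` Z) \<inter> span U = {0}" using assms(5) span_zero by blast
  qed (use that assms in auto)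
  have le: "dim (v ` Z \<union> U) \<le> dim (v ` Z) + dim U" if "finite Z" for Z
    using dim_Un_span_Int[of "v ` Z" U] assms(3) that by (simp add: fin_dim_finite)
  have "dim (v ` (X \<union> Y)) \<le> dim (v ` (X \<union> Y) \<union> U)"
    by (rule dim_mono_fin_dim) (use assms in \<open>auto intro: fin_dim_Un fin_dim_finite span_base\<close>)
  then show ?thesis
    using eq[of X] eq[of Y] eq[of "X \<union> Y"] le[of X] le[of Y] assms(1,2) unfolding lam_def by simp
qed

text \<open>Adding the subspace \<open>X\<close> to the side \<open>A\<close> that it overlaps less enlarges the intersection of
  the two sides by at least half the codimension of \<open>X \<inter> A \<inter> B\<close> in \<open>X \<inter> span (A \<union> B)\<close>.\<close>

lemma overlap_step:
  assumes sub: "subspace A" "subspace B" "subspace X"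
    and fd: "fin_dim A" "fin_dim B" "fin_dim X" "fin_dim W"
    and IH: "dim (W \<union> (A \<inter> B)) \<le> 3 * dim (A \<inter> B)"
    and le: "dim (X \<inter> A) \<le> dim (X \<inter> B)"
  shows "dim (W \<union> (X \<inter> span (A \<union> B)) \<union> (span (A \<union> X) \<inter> B)) \<le> 3 * dim (span (A \<union> X) \<inter> B)"
proof -
  define Z where "Z = A \<inter> B"
  define U where "U = X \<inter> span (A \<union> B)"
  define Z' where "Z' = span (A \<union> X) \<inter> B"
  have fAB: "fin_dim (A \<union> B)" and fAX: "fin_dim (A \<union> X)" by (simp_all add: fin_dim_Un fd)
  have fU: "fin_dim U" and fZ: "fin_dim Z" and fZ': "fin_dim Z'"
    using fin_dim_subset[OF fd(3), of U] fin_dim_subset[OF fd(1), of Z] fin_dim_subset[OF fd(2), of Z']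
      span_superset by (auto simp: U_def Z_def Z'_def)
  have sU: "subspace U" and sZ: "subspace Z" and sZ': "subspace Z'"
    by (simp_all add: U_def Z_def Z'_def subspace_inter sub)
  have ZZ': "Z \<subseteq> Z'" by (auto simp: Z_def Z'_def intro: span_base)
  have "dim (A \<union> B) + dim Z = dim A + dim B"
    unfolding Z_def by (rule dim_Un_Int) (simp_all add: sub fd)
  moreover have "dim (A \<union> X) + dim (X \<inter> A) = dim A + dim X"
    using dim_Un_Int[of A X] sub fd by (simp add: Int_commute)
  moreover have "dim (A \<union> B \<union> X) + dim U = dim (A \<union> B) + dim X"
    using dim_Un_Int[of "span (A \<union> B)" X] sub fd fAB
    by (simp add: U_def Int_commute dim_Un_span_left fin_dim_span)
  moreover have "dim (A \<union> X \<union> B) + dim Z' = dim (A \<union> X) + dim B"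
    using dim_Un_Int[of "span (A \<union> X)" B] sub fd fAX
    by (simp add: Z'_def dim_Un_span_left fin_dim_span)
  moreover have "A \<union> X \<union> B = A \<union> B \<union> X" by blast
  \<comment> \<open>The dimension of \<open>A + B + X\<close> is counted twice, adding
    \<open>X\<close> to \<open>A + B\<close> and adding \<open>B\<close> to \<open>A + X\<close>.
    Thus the common part of the sides grows by \<open>dim U - dim (X \<inter> A)\<close>.\<close>
  ultimately have gain: "dim Z' + dim (X \<inter> A) = dim Z + dim U" by simp
  have overlap: "dim (X \<inter> A) + dim (X \<inter> B) \<le> dim U + dim (U \<inter> Z)"
  proof -
    have "fin_dim (X \<inter> A)" "fin_dim (X \<inter> B)"
      by (auto intro!: fin_dim_subset[OF fd(3)] intro: span_base)
    then have "dim (X \<inter> A \<union> X \<inter> B) + dim (X \<inter> A \<inter> (X \<inter> B)) = dim (X \<inter> A) + dim (X \<inter> B)"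
      by (intro dim_Un_Int) (simp_all add: sub subspace_inter)
    moreover have "X \<inter> A \<inter> (X \<inter> B) = U \<inter> Z" by (auto simp: U_def Z_def intro: span_base)
    moreover have "dim (X \<inter> A \<union> X \<inter> B) \<le> dim U"
      by (rule dim_mono_fin_dim[OF fU]) (auto simp: U_def intro!: span_base)
    ultimately show ?thesis by simp
  qed
  have "dim (W \<union> Z \<union> U) + dim (span (W \<union> Z) \<inter> span U) = dim (W \<union> Z) + dim U"
    by (rule dim_Un_span_Int) (simp_all add: fin_dim_Un fd fZ fU)
  moreover have "dim (U \<inter> Z) \<le> dim (span (W \<union> Z) \<inter> span U)"
  proof (rule dim_mono_fin_dim)
    show "fin_dim (span (W \<union> Z) \<inter> span U)" by (rule fin_dim_subset[OF fU]) auto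
  qed (auto intro!: span_base)
  ultimately have 1: "dim (W \<union> Z \<union> U) + dim (U \<inter> Z) \<le> dim (W \<union> Z) + dim U" by simp
  have "dim (W \<union> Z \<union> U \<union> Z') + dim (span (W \<union> Z \<union> U) \<inter> span Z') = dim (W \<union> Z \<union> U) + dim Z'"
    by (rule dim_Un_span_Int) (simp_all add: fin_dim_Un fd fZ fU fZ')
  moreover have "dim Z \<le> dim (span (W \<union> Z \<union> U) \<inter> span Z')"
  proof (rule dim_mono_fin_dim)
    show "fin_dim (span (W \<union> Z \<union> U) \<inter> span Z')" by (rule fin_dim_subset[OF fZ']) auto
  qed (use ZZ' in \<open>auto intro!: span_base\<close>)
  moreover have "W \<union> Z \<union> U \<union> Z' = W \<union> U \<union> Z'" using ZZ' by blast
  ultimately have 2: "dim (W \<union> U \<union> Z') + dim Z \<le> dim (W \<union> Z \<union> U) + dim Z'" by simp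
  \<comment> \<open>The 3 is 2 + 1. By \<open>overlap\<close> and \<open>le\<close> the genuinely
    new dimension \<open>dim U - dim (U \<inter> Z)\<close> is at most twice the gain
    \<open>dim Z' - dim Z\<close>, and enlarging \<open>Z\<close> to \<open>Z'\<close> costs at most
    one further gain.\<close>
  have "dim (W \<union> U \<union> Z') \<le> 3 * dim Z'"
    using 1 2 gain overlap le IH unfolding Z_def[symmetric] by linarith
  then show ?thesis by (simp add: U_def Z'_def)
qed

text \<open>The invariant measures the overlaps together with the intersection of the two sides;
  with the overlaps alone the induction would not go through, because a new overlap may already be
  partly contained in that intersection. The two cases apply \<open>overlap_step\<close> with the
  sides exchanged.\<close>

lemma overlap_partition:
  fixes V :: "nat \<Rightarrow> 'b set"
  assumes fd: "\<And>i. i < n \<Longrightarrow> fin_dim (V i)" and sub: "\<And>i. i < n \<Longrightarrow> subspace (V i)"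
  defines "S \<equiv> \<lambda>I. span (\<Union>i\<in>I. V i)"
  shows "\<exists>I\<subseteq>{..<n}. dim ((\<Union>i<n. V i \<inter> S {..<i}) \<union> (S I \<inter> S ({..<n} - I))) \<le> 3 * dim (S I \<inter> S ({..<n} - I))"
  using fd sub
proof (induction n)
  case 0
  then show ?case by (simp add: S_def)
next
  case (Suc n)
  then obtain I where I: "I \<subseteq> {..<n}"
    "dim ((\<Union>i<n. V i \<inter> S {..<i}) \<union> (S I \<inter> S ({..<n} - I))) \<le> 3 * dim (S I \<inter> S ({..<n} - I))"
    by (meson less_SucI)
  define J where "J = {..<n} - I"
  define W where "W = (\<Union>i<n. V i \<inter> S {..<i})"
  have IJ: "I \<union> J = {..<n}" using I by (auto simp: J_def)
  have fS: "fin_dim (S K)" if "K \<subseteq> {..<n}" for K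
    using that finite_subset Suc.prems unfolding S_def
    by (intro fin_dim_span fin_dim_UN) (auto intro: finite_subset)
  have S_Un: "span (S K \<union> V n) = S (insert n K)" "span (V n \<union> S K) = S (insert n K)" for K
    unfolding S_def using span_mono[of "\<Union>(V ` K)" "\<Union>(V ` insert n K)"]
    by (auto simp: span_eq intro: span_base)
  have S_IJ: "span (S I \<union> S J) = S {..<n}"
  proof -
    have "span (\<Union>(V ` I)) \<subseteq> span (\<Union>(V ` {..<n}))" "span (\<Union>(V ` J)) \<subseteq> span (\<Union>(V ` {..<n}))"
      using IJ by (auto intro!: span_mono)
    then show ?thesis unfolding S_def IJ[symmetric] by (auto simp: span_eq intro: span_base)
  qed
  have sS: "subspace (S K)" for K by (simp add: S_def)
  have fW: "fin_dim W" unfolding W_def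
  proof (rule fin_dim_UN)
    fix i assume "i \<in> {..<n}"
    then have "fin_dim (V i)" using Suc.prems by simp
    then show "fin_dim (V i \<inter> S {..<i})" by (rule fin_dim_subset) (auto intro: span_base)
  qed simp
  have fV: "fin_dim (V n)" "subspace (V n)" using Suc.prems by simp_all
  have fIJ: "fin_dim (S I)" "fin_dim (S J)" using fS I by (auto simp: J_def)
  have W': "(\<Union>i<Suc n. V i \<inter> S {..<i}) = W \<union> (V n \<inter> S {..<n})" by (auto simp: W_def lessThan_Suc)
  show ?case
  proof (cases "dim (V n \<inter> S I) \<le> dim (V n \<inter> S J)")
    case True
    have "dim (W \<union> (V n \<inter> span (S I \<union> S J)) \<union> (span (S I \<union> V n) \<inter> S J)) \<le> 3 * dim (span (S I \<union> V n) \<inter> S J)"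
      by (rule overlap_step) (use sS fV fIJ fW I True in \<open>simp_all add: W_def J_def\<close>)
    moreover have "{..<Suc n} - insert n I = J" using I by (auto simp: J_def)
    ultimately show ?thesis using I W' unfolding S_Un S_IJ
      by (intro exI[of _ "insert n I"]) auto
  next
    case False
    have "dim (W \<union> (V n \<inter> span (S J \<union> S I)) \<union> (span (S J \<union> V n) \<inter> S I)) \<le> 3 * dim (span (S J \<union> V n) \<inter> S I)"
      by (rule overlap_step) (use sS fV fIJ fW I False in \<open>simp_all add: W_def J_def Int_commute\<close>)
    moreover have "{..<Suc n} - I = insert n J" using I by (auto simp: J_def)
    moreover have "span (S J \<union> S I) = S {..<n}" using S_IJ by (simp add: Un_commute)
    ultimately show ?thesis using I W' unfolding S_Un
      by (intro exI[of _ I]) (auto simp: Int_commute)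
  qed
qed

text \<open>By the modular law the intersection of the spans of the two sides has dimension exactly
  \<open>lam\<close> of this bipartition, which \<open>lam_star\<close> bounds by
  \<open>r\<close>.\<close>

lemma dim_overlaps_le:
  fixes X :: "nat \<Rightarrow> 'i set"
  assumes fin: "\<And>i. i < n \<Longrightarrow> finite (X i)"
    and lam: "lam_star (\<lambda>Y. dim (v ` Y)) {..<n} X \<le> r"
  shows "dim (\<Union>i<n. span (v ` X i) \<inter> span (v ` (\<Union>j<i. X j))) \<le> 3 * r"
proof -
  define S where "S = (\<lambda>I. span (\<Union>i\<in>I. span (v ` X i)))"
  have S: "S I = span (v ` (\<Union>i\<in>I. X i))" for I
  proof -
    have "span (v ` X i) \<subseteq> span (v ` (\<Union>i\<in>I. X i))" if "i \<in> I" for i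
      using that by (intro span_mono) auto
    then have "(\<Union>i\<in>I. span (v ` X i)) \<subseteq> span (v ` (\<Union>i\<in>I. X i))" by blast
    moreover have "v ` (\<Union>i\<in>I. X i) \<subseteq> (\<Union>i\<in>I. span (v ` X i))" by (auto intro: span_base)
    ultimately show ?thesis
      unfolding S_def span_eq using span_superset[of "\<Union>i\<in>I. span (v ` X i)"] by blast
  qed
  have f1: "fin_dim (span (v ` X i))" if "i < n" for i
    using fin[OF that] by (simp add: fin_dim_span fin_dim_finite)
  obtain I where I: "I \<subseteq> {..<n}"
    "dim ((\<Union>i<n. span (v ` X i) \<inter> S {..<i}) \<union> (S I \<inter> S ({..<n} - I))) \<le> 3 * dim (S I \<inter> S ({..<n} - I))"
    using overlap_partition[of n "\<lambda>i. span (v ` X i)"] f1 unfolding S_def by auto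
  have finU: "finite (\<Union>i\<in>K. X i)" if "K \<subseteq> {..<n}" for K
  proof (rule finite_UN_I)
    show "finite K" using that by (rule finite_subset) simp
  qed (use that fin in auto)
  have fd: "fin_dim (v ` (\<Union>i\<in>K. X i))" if "K \<subseteq> {..<n}" for K
    using finU[OF that] by (simp add: fin_dim_finite)
  have UN: "(\<Union>i\<in>I. X i) \<union> (\<Union>i\<in>{..<n} - I. X i) = (\<Union>i<n. X i)" using I(1) by blast
  have "dim (v ` (\<Union>i<n. X i)) + dim (S I \<inter> S ({..<n} - I))
      = dim (v ` (\<Union>i\<in>I. X i)) + dim (v ` (\<Union>i\<in>{..<n} - I. X i))"
    using dim_Un_span_Int[OF fd[OF I(1)] fd[of "{..<n} - I"]] unfolding S image_Un[symmetric] UN by simp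
  then have "dim (S I \<inter> S ({..<n} - I)) = lam (\<lambda>Y. dim (v ` Y)) (\<Union>i\<in>I. X i) (\<Union>i\<in>{..<n} - I. X i)"
    unfolding lam_def UN by simp
  also have "\<dots> \<le> lam_star (\<lambda>Y. dim (v ` Y)) {..<n} X"
    unfolding lam_star_def by (rule Max_ge) (use I(1) in auto)
  finally have Z: "dim (S I \<inter> S ({..<n} - I)) \<le> r" using lam by simp
  have fW: "fin_dim ((\<Union>i<n. span (v ` X i) \<inter> S {..<i}) \<union> (S I \<inter> S ({..<n} - I)))"
  proof (rule fin_dim_subset[OF fd[OF subset_refl]])
    have "span (v ` X i) \<subseteq> span (v ` (\<Union>i<n. X i))" if "i < n" for i
      using that by (intro span_mono) auto
    moreover have "S I \<subseteq> span (v ` (\<Union>i<n. X i))" unfolding S using I(1) by (intro span_mono) auto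
    ultimately show "(\<Union>i<n. span (v ` X i) \<inter> S {..<i}) \<union> (S I \<inter> S ({..<n} - I)) \<subseteq> span (v ` (\<Union>i<n. X i))"
      by blast
  qed
  have "dim (\<Union>i<n. span (v ` X i) \<inter> S {..<i})
      \<le> dim ((\<Union>i<n. span (v ` X i) \<inter> S {..<i}) \<union> (S I \<inter> S ({..<n} - I)))"
    by (rule dim_mono_fin_dim[OF fW]) (auto intro: span_base)
  then show ?thesis using I(2) Z unfolding S by simp
qed

end

section \<open>Representations and their extensions\<close>

definition fscale :: "'f::field \<Rightarrow> (nat \<Rightarrow> 'f) \<Rightarrow> nat \<Rightarrow> 'f" where
  "fscale c v = (\<lambda>i. c * v i)"

interpretation fv: vector_space "fscale :: 'f::field \<Rightarrow> _"
  by unfold_locales (auto simp: fscale_def fun_eq_iff algebra_simps)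

lemma fscale_apply: "fscale c v i = c * v i"
  by (simp add: fscale_def)

lemma sum_fun_apply: "(\<Sum>x\<in>A. f x) i = (\<Sum>x\<in>A. f x i)"
  for f :: "'a \<Rightarrow> 'b \<Rightarrow> 'c::ab_group_add"
  by (induction A rule: infinite_finite_induct) auto

abbreviation vrank :: "('a \<Rightarrow> nat \<Rightarrow> 'f::field) \<Rightarrow> 'a set \<Rightarrow> nat" where
  "vrank v X \<equiv> fv.dim (v ` X)"

definition unit_vec :: "nat \<Rightarrow> nat \<Rightarrow> 'f::field" where
  "unit_vec c = (\<lambda>i. if i = c then 1 else 0)"

text \<open>\<open>lin_indep\<close> speaks of a family indexed by elements, so parallel elements
  with equal vectors are dependent; for the set of vectors this has to be added as
  injectivity.\<close>

lemma lin_indep_iff: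
  assumes "finite Y"
  shows "lin_indep v Y \<longleftrightarrow> inj_on v Y \<and> fv.independent (v ` Y)"
proof
  assume *: "lin_indep v Y"
  have inj: "inj_on v Y"
  proof (rule inj_onI, rule ccontr)
    fix x y assume xy: "x \<in> Y" "y \<in> Y" "v x = v y" "x \<noteq> y"
    define c where "c = (\<lambda>z. if z = x then 1 else if z = y then -1 else 0 :: 'b)"
    have "(\<Sum>z\<in>Y. c z * v z i) = 0" for i
    proof -
      have "(\<Sum>z\<in>Y. c z * v z i) = (\<Sum>z\<in>{x, y}. c z * v z i)"
        using xy assms by (intro sum.mono_neutral_right) (auto simp: c_def)
      then show ?thesis using xy by (simp add: c_def)
    qed
    then have "c x = 0" using * xy unfolding lin_indep_def by blast
    then show False by (simp add: c_def)
  qed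
  moreover have "fv.independent (v ` Y)"
  proof (rule fv.independent_if_scalars_zero)
    fix f w assume s: "(\<Sum>w\<in>v ` Y. fscale (f w) w) = 0" and w: "w \<in> v ` Y"
    have "(\<Sum>x\<in>Y. f (v x) * v x i) = 0" for i
      using fun_cong[OF s, of i] by (simp add: sum.reindex[OF inj] sum_fun_apply fscale_apply)
    then have "\<forall>x\<in>Y. f (v x) = 0" 
      using *[unfolded lin_indep_def, rule_format, of "\<lambda>x. f (v x)"] by simp
    then show "f w = 0" using w by blast
  qed (simp add: assms)
  ultimately show "inj_on v Y \<and> fv.independent (v ` Y)" by blast
next
  assume *: "inj_on v Y \<and> fv.independent (v ` Y)"
  show "lin_indep v Y" unfolding lin_indep_def
  proof (intro allI impI)
    fix c :: "'a \<Rightarrow> 'b" assume s: "\<forall>i. (\<Sum>x\<in>Y. c x * v x i) = 0"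
    define u where "u = (\<lambda>w. c (inv_into Y v w))"
    have u: "u (v x) = c x" if "x \<in> Y" for x using * that by (simp add: u_def)
    have "(\<Sum>w\<in>v ` Y. fscale (u w) w) = (\<Sum>x\<in>Y. fscale (c x) (v x))"
      using * u by (simp add: sum.reindex cong: sum.cong)
    also have "\<dots> = 0" using s by (auto simp: fun_eq_iff sum_fun_apply fscale_apply)
    finally have "u w = 0" if "w \<in> v ` Y" for w
      using fv.independentD[of "v ` Y" "v ` Y" u w] * assms that by blast
    then show "\<forall>x\<in>Y. c x = 0" using u by force
  qed
qed

lemma lin_rank_eq_vrank:
  assumes "finite X" shows "lin_rank v X = vrank v X"
  unfolding lin_rank_def
proof (rule Max_eqI)
  have "{card Y |Y. Y \<subseteq> X \<and> lin_indep v Y} \<subseteq> card ` Pow X" by blast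
  then show "finite {card Y |Y. Y \<subseteq> X \<and> lin_indep v Y}" using assms by (meson finite_Pow_iff finite_imageI finite_subset)
next
  fix k assume "k \<in> {card Y |Y. Y \<subseteq> X \<and> lin_indep v Y}"
  then obtain Y where Y: "Y \<subseteq> X" "lin_indep v Y" "k = card Y" by blast
  have "finite Y" using Y(1) assms by (rule finite_subset)
  then have "inj_on v Y" "fv.independent (v ` Y)" using Y lin_indep_iff by blast+
  then have "k = fv.dim (v ` Y)" using Y by (simp add: fv.dim_eq_card_independent card_image)
  also have "\<dots> \<le> fv.dim (v ` X)"
    by (rule fv.dim_mono_fin_dim) (use assms Y in \<open>auto intro: fv.fin_dim_finite fv.span_base\<close>)
  finally show "k \<le> vrank v X" .
next
  obtain B where B: "B \<subseteq> v ` X" "fv.independent B" "card B = fv.dim (v ` X)" by (rule fv.basis_exists)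
  then obtain Y where Y: "Y \<subseteq> X" "inj_on v Y" "B = v ` Y" by (meson subset_image_inj)
  have "finite Y" using Y(1) assms by (rule finite_subset)
  then have "lin_indep v Y" "card Y = vrank v X"
    using Y B lin_indep_iff[of Y v] by (auto simp: card_image)
  then show "vrank v X \<in> {card Y |Y. Y \<subseteq> X \<and> lin_indep v Y}"
    using Y(1) unfolding mem_Collect_eq by (intro exI[of _ Y]) simp
qed

section \<open>Fresh coordinates and extensions\<close>

lemma subspace_support: "fv.subspace {x. \<forall>i. i \<notin> A \<longrightarrow> x i = 0}"
  by (rule fv.subspaceI) (auto simp: fscale_apply)

lemma span_support:
  assumes "x \<in> fv.span S" "\<And>s i. s \<in> S \<Longrightarrow> i \<notin> A \<Longrightarrow> s i = 0" "i \<notin> A"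
  shows "x i = 0"
  using fv.span_minimal[OF _ subspace_support, of S A] assms by blast

lemma span_unit_support: "x \<in> fv.span (unit_vec ` C) \<Longrightarrow> i \<notin> C \<Longrightarrow> x i = 0"
  by (rule span_support[of x "unit_vec ` C" C]) (auto simp: unit_vec_def)

text \<open>Coordinates separate the summands: below \<open>m\<close> only \<open>S\<close> and
  \<open>T\<close> contribute, and from \<open>m\<close> on the two fresh parts have disjoint
  supports. Hence a common vector has its low part in both spans and its high part zero.\<close>

lemma span_Un_unit_Int:
  assumes "\<And>s i. s \<in> S \<union> T \<Longrightarrow> m \<le> i \<Longrightarrow> s i = 0"
    and "C \<subseteq> {m..}" "D \<subseteq> {m..}" "C \<inter> D = {}" "fv.span S \<inter> fv.span T = {0}"
  shows "fv.span (S \<union> unit_vec ` C) \<inter> fv.span (T \<union> unit_vec ` D) = {0}"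
proof -
  have "z = 0" if z: "z \<in> fv.span (S \<union> unit_vec ` C)" "z \<in> fv.span (T \<union> unit_vec ` D)" for z
  proof -
    obtain a c where ac: "z = a + c" "a \<in> fv.span S" "c \<in> fv.span (unit_vec ` C)"
      using z(1) unfolding fv.span_Un by blast
    obtain b d where bd: "z = b + d" "b \<in> fv.span T" "d \<in> fv.span (unit_vec ` D)"
      using z(2) unfolding fv.span_Un by blast
    have hi: "a i = 0" "b i = 0" if "m \<le> i" for i
      using span_support[OF ac(2), of "{..<m}"] span_support[OF bd(2), of "{..<m}"] assms(1) that by auto
    have lo: "c i = 0" "d i = 0" if "i < m" for i
    proof -
      have "i \<notin> C" "i \<notin> D" using assms(2,3) that by auto
      then show "c i = 0" "d i = 0" using span_unit_support[OF ac(3)] span_unit_support[OF bd(3)] by auto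
    qed
    have eq: "a i + c i = b i + d i" for i using ac(1) bd(1) by (metis plus_fun_apply)
    have "a i = b i" for i using eq[of i] hi[of i] lo[of i] by (cases "i < m") auto
    then have "a = b" by (rule ext)
    then have "a \<in> fv.span S \<inter> fv.span T" using ac(2) bd(2) by simp
    then have "a = 0" unfolding assms(5) by simp
    moreover have "c i = 0" for i
    proof (cases "i \<in> C")
      case True
      then have "d i = 0" using span_unit_support[OF bd(3)] assms(4) by blast
      then show ?thesis using eq[of i] \<open>a = b\<close> by simp
    next
      case False
      then show ?thesis using span_unit_support[OF ac(3)] by blast
    qed
    ultimately show "z = 0" using ac(1) by (simp add: fun_eq_iff)
  qed
  then show ?thesis by (auto simp: fv.span_zero)
qed

text \<open>The elements \<open>Inr c\<close> with \<open>c \<in> C\<close> are to be contracted and those with \<open>c \<in> D\<close> deleted;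
  the vector of a contracted element \<open>Inr c\<close> is the \<open>c\<close>-th unit vector, and the coordinates of \<open>v\<close>
  are the ones below \<open>m\<close>.\<close>

definition extension ::
  "('a \<Rightarrow> nat \<Rightarrow> 'f::field) \<Rightarrow> 'a set \<Rightarrow> nat \<Rightarrow> nat set \<Rightarrow> nat set \<Rightarrow> ('a + nat \<Rightarrow> nat \<Rightarrow> 'f) \<Rightarrow> bool" where
  "extension v E m C D u \<longleftrightarrow> finite C \<and> finite D \<and> C \<inter> D = {} \<and> C \<union> D \<subseteq> {m..} \<and>
     (\<forall>x\<in>E. u (Inl x) - v x \<in> fv.span (unit_vec ` C)) \<and>
     (\<forall>c\<in>C. u (Inr c) = unit_vec c) \<and>
     (\<forall>d\<in>D. u (Inr d) \<in> fv.span (v ` E \<union> unit_vec ` C))"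

abbreviation ground :: "'a set \<Rightarrow> nat set \<Rightarrow> nat set \<Rightarrow> ('a + nat) set" where
  "ground E C D \<equiv> Inl ` E \<union> Inr ` (C \<union> D)"

text \<open>The reason for confining the deleted vectors: an extended block never leaves its own
  span plus its own fresh coordinates, so directness of blocks survives extension.\<close>

lemma extension_span:
  assumes "extension v E m C D u"
  shows "u ` ground E C D \<subseteq> fv.span (v ` E \<union> unit_vec ` C)"
proof -
  let ?S = "fv.span (v ` E \<union> unit_vec ` C)"
  have "u (Inl x) \<in> ?S" if "x \<in> E" for x
  proof -
    have "u (Inl x) - v x \<in> ?S"
      using assms that fv.span_mono[of "unit_vec ` C" "v ` E \<union> unit_vec ` C"]
      unfolding extension_def by blast
    then have "v x + (u (Inl x) - v x) \<in> ?S"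
      using that by (intro fv.span_add) (auto intro: fv.span_base)
    then show ?thesis by simp
  qed
  moreover have "u (Inr c) \<in> ?S" if "c \<in> C" for c
    using assms that unfolding extension_def by (auto intro: fv.span_base)
  moreover have "u (Inr d) \<in> ?S" if "d \<in> D" for d
    using assms that unfolding extension_def by blast
  ultimately show ?thesis by blast
qed

text \<open>Contracting the unit vectors forgets the coordinates in \<open>C\<close>; what remains
  of \<open>u (Inl x)\<close> is \<open>v x\<close>, which has no entries there.\<close>

lemma extension_rank:
  assumes ext: "extension v E m C D u" and X: "X \<subseteq> E" "finite X"
    and supp: "\<And>x i. x \<in> E \<Longrightarrow> m \<le> i \<Longrightarrow> v x i = 0"
  shows "vrank v X = vrank u (Inl ` X \<union> Inr ` C) - vrank u (Inr ` C)"
proof -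
  have C: "u ` Inr ` C = unit_vec ` C" "finite C" "C \<subseteq> {m..}" using ext by (auto simp: extension_def image_image)
  have "fv.dim ((\<lambda>x. u (Inl x)) ` X \<union> u ` Inr ` C) = fv.dim (v ` X) + fv.dim (u ` Inr ` C)"
    unfolding C(1)
  proof (rule fv.dim_Un_perturb)
    show "fv.span (v ` X) \<inter> fv.span (unit_vec ` C) = {0}"
      using span_Un_unit_Int[of "v ` X" "{}" m "{}" C] supp X C(3) by (auto simp: fv.span_zero)
  qed (use ext X C in \<open>auto simp: extension_def intro: fv.fin_dim_finite\<close>)
  then show ?thesis by (simp add: image_Un image_image)
qed

text \<open>Raising the floor of the second extension to \<open>m'\<close> makes its indices
  disjoint from those of the first. The two ground sets then form a direct sum, for which the bound
  is the common \<open>k\<close> and not a sum of bounds.\<close>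

lemma extension_sum:
  fixes v :: "'a \<Rightarrow> nat \<Rightarrow> 'f::field"
  assumes e1: "extension v A m C1 D1 u1" and lt: "C1 \<union> D1 \<subseteq> {..<m'}" and m: "m \<le> m'"
    and e2: "extension v B m' C2 D2 u2"
    and dis: "A \<inter> B = {}" "A \<noteq> {}" "B \<noteq> {}" "finite A" "finite B"
    and dir: "fv.span (v ` A) \<inter> fv.span (v ` B) = {0}"
    and supp: "\<And>x i. x \<in> A \<union> B \<Longrightarrow> m \<le> i \<Longrightarrow> v x i = 0"
    and b1: "cdd_bound (ground A C1 D1) (vrank u1) k"
    and b2: "cdd_bound (ground B C2 D2) (vrank u2) k"
  shows "\<exists>u. extension v (A \<union> B) m (C1 \<union> C2) (D1 \<union> D2) u \<and>
    cdd_bound (ground (A \<union> B) (C1 \<union> C2) (D1 \<union> D2)) (vrank u) k"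
proof -
  let ?P = "ground A C1 D1" and ?Q = "ground B C2 D2"
  define u where "u = (\<lambda>y. if y \<in> ?P then u1 y else u2 y)"
  have ge: "C2 \<union> D2 \<subseteq> {m'..}" using e2 by (simp add: extension_def)
  have sep: "(C1 \<union> D1) \<inter> (C2 \<union> D2) = {}"
  proof -
    have "{..<m'} \<inter> {m'..} = {}" by auto
    then show ?thesis using lt ge by blast
  qed
  have PQ: "?P \<inter> ?Q = {}" using sep dis(1) by auto
  have uP': "u y = u1 y" if "y \<in> ?P" for y unfolding u_def using that by (rule if_P)
  have uQ': "u y = u2 y" if "y \<in> ?Q" for y
  proof -
    have "y \<notin> ?P" using that PQ by (metis IntI empty_iff)
    then show ?thesis unfolding u_def by (rule if_not_P)
  qed
  have uP: "u ` X = u1 ` X" if "X \<subseteq> ?P" for X using uP' that by (intro image_cong) blast+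
  have uQ: "u ` X = u2 ` X" if "X \<subseteq> ?Q" for X using uQ' that by (intro image_cong) blast+
  have mono1: "fv.span (v ` A \<union> unit_vec ` C1) \<subseteq> fv.span (v ` (A \<union> B) \<union> unit_vec ` (C1 \<union> C2))"
    and mono2: "fv.span (v ` B \<union> unit_vec ` C2) \<subseteq> fv.span (v ` (A \<union> B) \<union> unit_vec ` (C1 \<union> C2))"
    and mono3: "fv.span (unit_vec ` C1 :: (nat \<Rightarrow> 'f) set) \<subseteq> fv.span (unit_vec ` (C1 \<union> C2))"
    and mono4: "fv.span (unit_vec ` C2 :: (nat \<Rightarrow> 'f) set) \<subseteq> fv.span (unit_vec ` (C1 \<union> C2))"
    by (rule fv.span_mono, blast)+
  have "extension v (A \<union> B) m (C1 \<union> C2) (D1 \<union> D2) u"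
    unfolding extension_def
  proof (intro conjI ballI)
    show "finite (C1 \<union> C2)" "finite (D1 \<union> D2)" using e1 e2 by (simp_all add: extension_def)
    show "(C1 \<union> C2) \<inter> (D1 \<union> D2) = {}" using e1 e2 sep unfolding extension_def by blast
    have "C1 \<union> D1 \<subseteq> {m..}" using e1 by (simp add: extension_def)
    then show "C1 \<union> C2 \<union> (D1 \<union> D2) \<subseteq> {m..}" using ge m by auto
    show "u (Inl x) - v x \<in> fv.span (unit_vec ` (C1 \<union> C2))" if "x \<in> A \<union> B" for x
      using that e1 e2 uP'[of "Inl x"] uQ'[of "Inl x"] mono3 mono4 unfolding extension_def by auto
    show "u (Inr c) = unit_vec c" if "c \<in> C1 \<union> C2" for c
      using that e1 e2 uP'[of "Inr c"] uQ'[of "Inr c"] unfolding extension_def by auto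
    show "u (Inr d) \<in> fv.span (v ` (A \<union> B) \<union> unit_vec ` (C1 \<union> C2))" if "d \<in> D1 \<union> D2" for d
      using that e1 e2 uP'[of "Inr d"] uQ'[of "Inr d"] mono1 mono2 unfolding extension_def by auto
  qed
  moreover have "cdd_bound (?P \<union> ?Q) (vrank u) k"
  proof (rule cdd_bound.sum)
    show "?P \<noteq> {}" "?Q \<noteq> {}" using dis by auto
    show "?P \<inter> ?Q = {}" by (rule PQ)
    have fP: "finite ?P" and fQ: "finite ?Q" using e1 e2 dis by (simp_all add: extension_def)
    have "fv.span (v ` A \<union> unit_vec ` C1) \<inter> fv.span (v ` B \<union> unit_vec ` C2) = {0}"
    proof (rule span_Un_unit_Int)
      show "s i = 0" if "s \<in> v ` A \<union> v ` B" "m \<le> i" for s i using that supp by auto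
      show "C1 \<subseteq> {m..}" "C2 \<subseteq> {m..}" using e1 ge m by (auto simp: extension_def)
      show "C1 \<inter> C2 = {}" using sep by blast
    qed (rule dir)
    moreover have "fv.span (u ` ?P) \<subseteq> fv.span (v ` A \<union> unit_vec ` C1)"
      using extension_span[OF e1] uP[of ?P] by (intro fv.span_minimal) auto
    moreover have "fv.span (u ` ?Q) \<subseteq> fv.span (v ` B \<union> unit_vec ` C2)"
      using extension_span[OF e2] uQ[of ?Q] by (intro fv.span_minimal) auto
    ultimately have "fv.span (u ` ?P) \<inter> fv.span (u ` ?Q) \<subseteq> {0}" by blast
    then have "fv.span (u ` ?P) \<inter> fv.span (u ` ?Q) = {0}" using fv.span_zero by blast
    then show "vrank u (?P \<union> ?Q) = vrank u ?P + vrank u ?Q"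
      unfolding image_Un[of u ?P ?Q] using fP fQ by (intro fv.dim_Un_direct) (auto intro: fv.fin_dim_finite)
    show "cdd_bound ?P (vrank u) k" by (rule cdd_bound_cong[OF b1]) (simp add: uP)
    show "cdd_bound ?Q (vrank u) k" by (rule cdd_bound_cong[OF b2]) (simp add: uQ)
  qed
  moreover have "?P \<union> ?Q = ground (A \<union> B) (C1 \<union> C2) (D1 \<union> D2)" by blast
  ultimately show ?thesis by metis
qed

text \<open>The last hypothesis offers every floor \<open>m'\<close>, because the floor needed for a
  block is known only once the earlier blocks have been extended.\<close>

lemma extension_UN:
  fixes X :: "nat \<Rightarrow> 'a set"
  assumes "0 < n"
    and "\<And>i. i < n \<Longrightarrow> finite (X i) \<and> X i \<noteq> {}"
    and "\<And>i j. i < n \<Longrightarrow> j < n \<Longrightarrow> i \<noteq> j \<Longrightarrow> X i \<inter> X j = {}"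
    and "\<And>i x l. i < n \<Longrightarrow> x \<in> X i \<Longrightarrow> m \<le> l \<Longrightarrow> v x l = 0"
    and "\<And>i. i < n \<Longrightarrow> fv.span (v ` (\<Union>j<i. X j)) \<inter> fv.span (v ` X i) = {0}"
    and "\<And>i m'. i < n \<Longrightarrow> m \<le> m' \<Longrightarrow> \<exists>C D u. extension v (X i) m' C D u \<and> cdd_bound (ground (X i) C D) (vrank u) k"
  shows "\<exists>C D u. extension v (\<Union>i<n. X i) m C D u \<and> cdd_bound (ground (\<Union>i<n. X i) C D) (vrank u) k"
  using assms
proof (induction n)
  case 0
  then show ?case by simp
next
  case (Suc n)
  show ?case
  proof (cases "n = 0")
    case True
    have "(\<Union>i<Suc n. X i) = X 0" using True by auto
    then show ?thesis using Suc.prems(6)[of 0 m] by simp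
  next
    case False
    have "\<exists>C D u. extension v (\<Union>i<n. X i) m C D u \<and> cdd_bound (ground (\<Union>i<n. X i) C D) (vrank u) k"
    proof (rule Suc.IH)
      show "v x l = 0" if "i < n" "x \<in> X i" "m \<le> l" for i x l using Suc.prems(4)[of i x l] that by simp
    qed (use False Suc.prems in auto)
    then obtain C1 D1 u1 where 1: "extension v (\<Union>i<n. X i) m C1 D1 u1"
      "cdd_bound (ground (\<Union>i<n. X i) C1 D1) (vrank u1) k" by blast
    have "finite (C1 \<union> D1)" using 1 by (simp add: extension_def)
    then obtain b where "C1 \<union> D1 \<subseteq> {..<b}" using finite_nat_set_iff_bounded by (metis lessThan_iff subsetI)
    then have lt: "C1 \<union> D1 \<subseteq> {..<max b m}" by auto
    obtain C2 D2 u2 where 2: "extension v (X n) (max b m) C2 D2 u2"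
      "cdd_bound (ground (X n) C2 D2) (vrank u2) k" using Suc.prems(6)[of n "max b m"] by auto
    have U: "(\<Union>i<Suc n. X i) = (\<Union>i<n. X i) \<union> X n" by (auto simp: lessThan_Suc)
    have ne: "(\<Union>i<n. X i) \<noteq> {}" using False Suc.prems(2)[of 0] by auto
    have "X i \<inter> X n = {}" if "i < n" for i using Suc.prems(3)[of i n] that by simp
    then have dis: "(\<Union>i<n. X i) \<inter> X n = {}" by blast
    have supp: "v x l = 0" if "x \<in> (\<Union>i<n. X i) \<union> X n" "m \<le> l" for x l
      using that Suc.prems(4)[of _ x l] by (auto simp: less_Suc_eq)
    have "\<exists>u. extension v ((\<Union>i<n. X i) \<union> X n) m (C1 \<union> C2) (D1 \<union> D2) u \<and>
      cdd_bound (ground ((\<Union>i<n. X i) \<union> X n) (C1 \<union> C2) (D1 \<union> D2)) (vrank u) k"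
      by (rule extension_sum[OF 1(1) lt _ 2(1) dis ne _ _ _ _ supp 1(2) 2(2)])
        (use Suc.prems(2)[of n] Suc.prems(2,5) in auto)
    then show ?thesis unfolding U by blast
  qed
qed

text \<open>Contracting the elements with vectors \<open>F b = b + unit_vec (g b)\<close> and deleting those with
  vectors \<open>unit_vec (g b)\<close> turns the extension of \<open>v\<close> into the given one of \<open>v'\<close>; exchanging the
  roles of the two families recovers \<open>v\<close>.\<close>

lemma extension_perturb:
  fixes v v' :: "'a \<Rightarrow> nat \<Rightarrow> 'f::field"
  assumes ext: "extension v' E m C D u'" and fin: "finite E" "finite W"
    and W: "W \<subseteq> fv.span (v ` E)" "v' ` E \<subseteq> fv.span (v ` E)"
    and diff: "\<And>x. x \<in> E \<Longrightarrow> v x - v' x \<in> fv.span W"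
    and supp: "\<And>x i. x \<in> E \<Longrightarrow> m \<le> i \<Longrightarrow> v x i = 0"
    and b: "cdd_bound (ground E C D) (vrank u') k"
  shows "\<exists>C D u. extension v E m C D u \<and> cdd_bound (ground E C D) (vrank u) (k + 2 * card W)"
proof -
  have CD: "finite C" "finite D" "C \<inter> D = {}" "C \<union> D \<subseteq> {m..}" using ext by (simp_all add: extension_def)
  have "finite (C \<union> D)" using CD by simp
  then obtain n0 where "C \<union> D \<subseteq> {..<n0}" using finite_nat_set_iff_bounded by (metis lessThan_iff subsetI)
  moreover define n where "n = max n0 m"
  ultimately have n: "C \<union> D \<subseteq> {..<n}" "m \<le> n" by auto
  obtain g0 where g0: "bij_betw g0 W {0..<card W}" using ex_bij_betw_finite_nat[OF fin(2)] by blast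
  \<comment> \<open>Each \<open>b\<close> receives two fresh indices but one fresh coordinate:
    \<open>g b\<close> is the coordinate of \<open>unit_vec (g b)\<close> and of \<open>F b\<close>,
    while \<open>h b\<close> names the element carrying \<open>F b\<close>. Starting at
    \<open>n\<close> avoids \<open>C\<close>, \<open>D\<close> and all coordinates below
    \<open>m\<close>.\<close>
  define g where "g = (\<lambda>b. n + g0 b)"
  define h where "h = (\<lambda>b. n + card W + g0 b)"
  have injg: "inj_on g W" and injh: "inj_on h W"
    using g0 by (auto simp: g_def h_def bij_betw_def inj_on_def)
  have g0_lt: "g0 b < card W" if "b \<in> W" for b using g0 that by (auto simp: bij_betw_def)
  have g_ge: "n \<le> g b" "g b < n + card W" if "b \<in> W" for b using g0_lt[OF that] by (simp_all add: g_def)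
  have h_ge: "n + card W \<le> h b" for b by (simp add: h_def)
  define F where "F = (\<lambda>b. b + unit_vec (g b) :: nat \<Rightarrow> 'f)"
  have "\<exists>w. v x - v' x = (\<Sum>b\<in>W. fscale (w b) b)" if "x \<in> E" for x
    using diff[OF that] unfolding fv.span_finite[OF fin(2)] by blast
  then obtain w where w: "\<And>x. x \<in> E \<Longrightarrow> v x - v' x = (\<Sum>b\<in>W. fscale (w x b) b)" by metis
  \<comment> \<open>The added sum serves both views: modulo the unit vectors it equals
    \<open>v x - v' x\<close>, which turns \<open>v'\<close> into \<open>v\<close>, and modulo the
    vectors \<open>F b\<close> it vanishes and leaves \<open>u'\<close>.\<close>
  define u where "u = (\<lambda>y. case y of
      Inl x \<Rightarrow> u' (Inl x) + (\<Sum>b\<in>W. fscale (w x b) (F b))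
    | Inr c \<Rightarrow> if c < n then u' (Inr c) else if c < n + card W then unit_vec c else F (inv_into W h c))"
  have u_Inl: "u (Inl x) = u' (Inl x) + (\<Sum>b\<in>W. fscale (w x b) (F b))" for x by (simp add: u_def)
  have u_lt: "u (Inr c) = u' (Inr c)" if "c < n" for c using that by (simp add: u_def)
  have u_g: "u (Inr (g b)) = unit_vec (g b)" if "b \<in> W" for b using g_ge[OF that] by (simp add: u_def)
  have u_h: "u (Inr (h b)) = F b" if "b \<in> W" for b
    using h_ge[of b] that injh by (simp add: u_def)
  define C' where "C' = C \<union> g ` W"
  define D' where "D' = D \<union> h ` W"
  have less_n: "c < n" if "c \<in> C \<union> D" for c using n(1) that by auto
  have unit_mono: "fv.span (unit_vec ` C :: (nat \<Rightarrow> 'f) set) \<subseteq> fv.span (unit_vec ` C')"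
    by (rule fv.span_mono) (auto simp: C'_def)
  have v_mono: "fv.span (v ` E) \<subseteq> fv.span (v ` E \<union> unit_vec ` C')"
    by (rule fv.span_mono) auto
  have unit_mono': "fv.span (unit_vec ` C' :: (nat \<Rightarrow> 'f) set) \<subseteq> fv.span (v ` E \<union> unit_vec ` C')"
    by (rule fv.span_mono) auto
  have ext': "extension v E m C' D' u"
    unfolding extension_def
  proof (intro conjI ballI)
    show "finite C'" "finite D'" using CD fin by (simp_all add: C'_def D'_def)
    have "g b \<noteq> h b'" if "b \<in> W" for b b' using g_ge[OF that] h_ge[of b'] by linarith
    moreover have "g b \<notin> C \<union> D" if "b \<in> W" for b using g_ge[OF that] less_n[of "g b"] by linarith
    moreover have "h b \<notin> C \<union> D" for b using h_ge[of b] less_n[of "h b"] by linarith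
    ultimately show "C' \<inter> D' = {}" using CD(3) unfolding C'_def D'_def by blast
    have "m \<le> g b" "m \<le> h b" for b using n(2) by (simp_all add: g_def h_def)
    then show "C' \<union> D' \<subseteq> {m..}" using CD(4) by (auto simp: C'_def D'_def)
  next
    fix x assume x: "x \<in> E"
    have "(\<Sum>b\<in>W. fscale (w x b) (F b)) = (v x - v' x) + (\<Sum>b\<in>W. fscale (w x b) (unit_vec (g b)))"
      unfolding w[OF x] F_def by (simp add: fv.scale_right_distrib sum.distrib)
    then have "u (Inl x) - v x = (u' (Inl x) - v' x) + (\<Sum>b\<in>W. fscale (w x b) (unit_vec (g b)))"
      unfolding u_Inl by simp
    moreover have "u' (Inl x) - v' x \<in> fv.span (unit_vec ` C')"
      using ext x unit_mono unfolding extension_def by blast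
    moreover have "(\<Sum>b\<in>W. fscale (w x b) (unit_vec (g b))) \<in> fv.span (unit_vec ` C')"
      by (intro fv.span_sum fv.span_scale fv.span_base) (auto simp: C'_def)
    ultimately show "u (Inl x) - v x \<in> fv.span (unit_vec ` C')" by (simp add: fv.span_add)
  next
    fix c assume "c \<in> C'"
    then show "u (Inr c) = unit_vec c"
      using ext less_n[of c] u_lt[of c] u_g by (auto simp: C'_def extension_def)
  next
    fix d assume "d \<in> D'"
    then consider "d \<in> D" | b where "b \<in> W" "d = h b" by (auto simp: D'_def)
    then show "u (Inr d) \<in> fv.span (v ` E \<union> unit_vec ` C')"
    proof cases
      case 1
      then have "u (Inr d) \<in> fv.span (v' ` E \<union> unit_vec ` C)"
        using ext less_n[of d] u_lt[of d] by (auto simp: extension_def)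
      moreover have "v' ` E \<union> unit_vec ` C \<subseteq> fv.span (v ` E \<union> unit_vec ` C')"
        using W(2) v_mono by (auto simp: C'_def intro: fv.span_base)
      ultimately show ?thesis using fv.span_minimal[OF _ fv.subspace_span] by (metis subsetD)
    next
      case 2
      have "b \<in> fv.span (v ` E \<union> unit_vec ` C')" using 2 W(1) v_mono by blast
      moreover have "unit_vec (g b) \<in> fv.span (v ` E \<union> unit_vec ` C')"
        using 2 by (intro fv.span_base) (auto simp: C'_def)
      ultimately show ?thesis using 2 u_h by (simp add: F_def fv.span_add)
    qed
  qed
  let ?G = "ground E C D" and ?P = "Inr ` g ` W :: ('a + nat) set" and ?H = "Inr ` h ` W :: ('a + nat) set"
  have G: "?G \<union> ?P \<union> ?H = ground E C' D'" by (auto simp: C'_def D'_def)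
  have uH: "u ` ?H = F ` W" using u_h by (force simp: image_image)
  have finG: "finite ?G" using fin CD by simp
  have W_supp: "b i = 0" if "b \<in> W" "m \<le> i" for b i
  proof (rule span_support[of b "v ` E" "{..<m}"])
    show "b \<in> fv.span (v ` E)" using W(1) that(1) by blast
  qed (use supp that in auto)
  have F_direct: "fv.span (u' ` X) \<inter> fv.span (F ` W) = {0}" if "X \<subseteq> ?G" for X
  proof -
    have "z = 0" if z: "z \<in> fv.span (u' ` X)" "z \<in> fv.span (F ` W)" for z
    proof -
      have inj: "inj_on F W"
      proof (rule inj_onI)
        fix b b' assume bb: "b \<in> W" "b' \<in> W" "F b = F b'"
        have "b (g b) = 0" "b' (g b) = 0" using W_supp bb g_ge[OF bb(1)] n(2) by simp_all
        moreover have "F b (g b) = F b' (g b)" using bb(3) by simp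
        ultimately have "g b = g b'" by (simp add: F_def unit_vec_def split: if_splits)
        then show "b = b'" using injg bb by (simp add: inj_on_def)
      qed
      have "finite (F ` W)" using fin(2) by simp
      then obtain c where "z = (\<Sum>f\<in>F ` W. fscale (c f) f)" using z(2) unfolding fv.span_finite[OF \<open>finite (F ` W)\<close>] by blast
      then have zc: "z = (\<Sum>b\<in>W. fscale (c (F b)) (F b))" by (simp add: sum.reindex[OF inj])
      have "c (F b) = 0" if bW: "b \<in> W" for b
      proof -
        have "u' ` X \<subseteq> fv.span (v' ` E \<union> unit_vec ` C)"
          using image_mono[OF \<open>X \<subseteq> ?G\<close>] extension_span[OF ext] by (rule subset_trans)
        from fv.span_minimal[OF this fv.subspace_span] have "z \<in> fv.span (v' ` E \<union> unit_vec ` C)"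
          using z(1) by (rule subsetD)
        then have "z (g b) = 0"
        proof (rule span_support[where A = "{..<n}"])
          fix s i assume s: "s \<in> v' ` E \<union> unit_vec ` C" and i: "i \<notin> {..<n}"
          show "s i = 0"
          proof (cases "s \<in> v' ` E")
            case True
            then have "s \<in> fv.span (v ` E)" using W(2) by blast
            then show ?thesis
              by (rule span_support[where A = "{..<m}"]) (use supp i n(2) in auto)
          next
            case False
            then obtain c where "s = unit_vec c" "c \<in> C" using s by blast
            then show ?thesis using less_n[of c] i by (auto simp: unit_vec_def)
          qed
        qed (use g_ge[OF bW] in auto)
        moreover have "z (g b) = (\<Sum>b'\<in>W. if b' = b then c (F b) else 0)"
          unfolding zc sum_fun_apply
        proof (rule sum.cong)
          fix b' assume b': "b' \<in> W"
          have "F b' (g b) = (if b' = b then 1 else 0)"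
            using W_supp[OF b', of "g b"] g_ge[OF bW] n(2) injg b' bW
            by (auto simp: F_def unit_vec_def inj_on_def)
          then show "fscale (c (F b')) (F b') (g b) = (if b' = b then c (F b) else 0)"
            by (simp add: fscale_apply)
        qed simp
        ultimately show ?thesis using fin(2) bW by simp
      qed
      then show "z = 0" unfolding zc by simp
    qed
    then show ?thesis by (auto simp: fv.span_zero)
  qed
  have "cdd_bound ?G (\<lambda>X. vrank u (X \<union> ?H) - vrank u ?H) k"
  proof (rule cdd_bound_cong[OF b])
    fix X assume X: "X \<subseteq> ?G"
    have "fv.dim (u ` X \<union> F ` W) = fv.dim (u' ` X) + fv.dim (F ` W)"
    proof (rule fv.dim_Un_perturb)
      show "finite X" using X finG by (rule finite_subset)
      show "fv.fin_dim (F ` W)" using fin(2) by (simp add: fv.fin_dim_finite)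
      show "fv.span (u' ` X) \<inter> fv.span (F ` W) = {0}" by (rule F_direct[OF X])
      fix y assume "y \<in> X"
      then consider x where "y = Inl x" | c where "y = Inr c" "c \<in> C \<union> D" using X by blast
      then show "u y - u' y \<in> fv.span (F ` W)"
      proof cases
        case 1
        have "(\<Sum>b\<in>W. fscale (w x b) (F b)) \<in> fv.span (F ` W)"
          by (intro fv.span_sum fv.span_scale fv.span_base) auto
        then show ?thesis using 1 u_Inl by simp
      next
        case 2
        then show ?thesis using u_lt less_n by (simp add: fv.span_zero)
      qed
    qed
    then show "vrank u (X \<union> ?H) - vrank u ?H = vrank u' X" by (simp add: image_Un uH del: image_image)
  qed
  moreover have "g b \<notin> C \<union> D" if "b \<in> W" for b using g_ge[OF that] less_n[of "g b"] by linarith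
  then have "?P \<inter> ?G = {}" by blast
  \<comment> \<open>A deletion costs one unit whatever the vector, so no rank involving
    \<open>?P\<close> has to be computed. Contracting \<open>?H\<close> afterwards doubles the cost
    to \<open>2 * card W\<close>.\<close>
  ultimately have del: "cdd_bound (?G \<union> ?P) (\<lambda>X. vrank u (X \<union> ?H) - vrank u ?H) (k + card ?P)"
    using fin(2) by (intro cdd_bound_delete_set) auto
  have dis: "?H \<inter> (?G \<union> ?P) = {}"
  proof -
    have "h b \<notin> C \<union> D" for b using h_ge[of b] less_n[of "h b"] by linarith
    moreover have "h b \<noteq> g b'" if "b' \<in> W" for b b' using g_ge[OF that] h_ge[of b] by linarith
    ultimately show ?thesis by blast
  qed
  have mat: "matroid_rank (?G \<union> ?P \<union> ?H) (vrank u)"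
    by (rule fv.matroid_rank_dim) (use finG fin in simp)
  have "cdd_bound (?G \<union> ?P \<union> ?H) (vrank u) (k + card ?P + card ?H)"
    by (rule cdd_bound_contract_set[OF _ dis mat del]) (simp add: fin)
  moreover have "card ?P = card W" "card ?H = card W"
    using injg injh by (simp_all add: card_image)
  ultimately have "cdd_bound (ground E C' D') (vrank u) (k + 2 * card W)" unfolding G by (simp add: mult_2 add.assoc)
  then show ?thesis using ext' by blast
qed


section \<open>Induction over the decomposition tree\<close>

lemma depth_child: "t \<in> set ts \<Longrightarrow> depth t \<le> fold max (map depth ts) 0"
  using Max.set_eq_fold[of 0 "map depth ts"] by (metis (no_types, lifting) List.finite_set Max_ge image_eqI
      list.set_intros(2) set_map)

lemma leaves_nonempty: "width_ok rk r T \<Longrightarrow> leaves T \<noteq> []"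
proof (induction T)
  case (Node ts)
  then have "ts \<noteq> []" by simp
  then have "hd ts \<in> set ts" by simp
  then show ?case using Node.IH[of "hd ts"] Node.prems by (auto simp: list_all_iff)
qed simp

lemma lam_le_lam_star: "finite P \<Longrightarrow> I \<subseteq> P \<Longrightarrow> lam rk (\<Union>i\<in>I. X i) (\<Union>i\<in>P - I. X i) \<le> lam_star rk P X"
  unfolding lam_star_def by (rule Max_ge) auto

text \<open>All sets compared at inner vertices consist of leaves of the whole tree, so one bound on
  pairs of leaf sets serves every vertex. With \<open>s = 0\<close> it exchanges rank functions that
  agree on the ground set.\<close>

lemma width_ok_perturb:
  assumes "width_ok rk r T"
    and "\<And>X Y. X \<subseteq> set (leaves T) \<Longrightarrow> Y \<subseteq> set (leaves T) \<Longrightarrow> lam rk' X Y \<le> lam rk X Y + s"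
  shows "width_ok rk' (r + s) T"
  using assms
proof (induction T)
  case (Leaf x)
  then show ?case by simp
next
  case (Node ts)
  let ?P = "{..<length ts}" and ?X = "\<lambda>i. set (leaves (ts ! i))"
  have sub: "(\<Union>i\<in>I. ?X i) \<subseteq> set (leaves (Node ts))" if "I \<subseteq> ?P" for I
    using that by (auto dest: nth_mem)
  have "lam_star rk' ?P ?X \<le> r + s"
    unfolding lam_star_def
  proof (rule Max.boundedI)
    fix k assume "k \<in> {lam rk' (\<Union>i\<in>I. ?X i) (\<Union>i\<in>?P - I. ?X i) | I. I \<subseteq> ?P}"
    then obtain I where I: "I \<subseteq> ?P" "k = lam rk' (\<Union>i\<in>I. ?X i) (\<Union>i\<in>?P - I. ?X i)" by blast
    have "k \<le> lam rk (\<Union>i\<in>I. ?X i) (\<Union>i\<in>?P - I. ?X i) + s"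
      unfolding I(2) by (intro Node.prems sub I) auto
    also have "\<dots> \<le> lam_star rk ?P ?X + s" using lam_le_lam_star[OF _ I(1)] by simp
    also have "\<dots> \<le> r + s" using Node.prems(1) by simp
    finally show "k \<le> r + s" .
  qed auto
  moreover have "width_ok rk' (r + s) t" if "t \<in> set ts" for t
  proof (rule Node.IH[OF that])
    show "width_ok rk r t" using Node.prems(1) that by (simp add: list_all_iff)
    fix X Y assume "X \<subseteq> set (leaves t)" "Y \<subseteq> set (leaves t)"
    then show "lam rk' X Y \<le> lam rk X Y + s" using that by (intro Node.prems) auto
  qed
  ultimately show ?case using Node.prems(1) by (simp add: list_all_iff)
qed

text \<open>The children have width \<open>4 * r\<close> and possibly different depths, so they are
  first brought to the common bound for depth \<open>d\<close>; adding the \<open>6 * r\<close> new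
  elements gives exactly the bound for depth \<open>Suc d\<close>.\<close>

lemma cdd_bound_recursion:
  assumes "e \<le> d"
  shows "2 * (r + 3 * r) * (4 ^ e - 1) + 1 \<le> 8 * r * (4 ^ d - 1) + (1::nat)"
    and "8 * r * (4 ^ d - 1) + 1 + 6 * r = 2 * r * (4 ^ Suc d - 1) + (1::nat)"
proof -
  have "(4::nat) ^ e - 1 \<le> 4 ^ d - 1" using assms by (intro diff_le_mono power_increasing) auto
  then show "2 * (r + 3 * r) * (4 ^ e - 1) + 1 \<le> 8 * r * (4 ^ d - 1) + (1::nat)" by simp
  obtain q where "(4::nat) ^ d = Suc q" by (metis not0_implies_Suc power_not_zero zero_neq_numeral)
  then show "8 * r * (4 ^ d - 1) + 1 + 6 * r = 2 * r * (4 ^ Suc d - 1) + (1::nat)"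
    by (simp add: algebra_simps)
qed

text \<open>All of \<open>v\<close>, \<open>r\<close> and \<open>m\<close> vary in the induction: a
  child is treated with the projected vectors, four times the width and a floor dictated by its
  siblings.\<close>

lemma decomposition_extension:
  fixes v :: "'a \<Rightarrow> nat \<Rightarrow> 'f::field"
  assumes "distinct (leaves T)" "width_ok (vrank v) r T"
    and "\<And>x i. x \<in> set (leaves T) \<Longrightarrow> m \<le> i \<Longrightarrow> v x i = 0"
  shows "\<exists>C D u. extension v (set (leaves T)) m C D u \<and>
    cdd_bound (ground (set (leaves T)) C D) (vrank u) (2 * r * (4 ^ depth T - 1) + 1)"
  using assms
proof (induction T arbitrary: v r m)
  case (Leaf x)
  have "extension v {x} m {} {} (\<lambda>y. case y of Inl x \<Rightarrow> v x | Inr c \<Rightarrow> 0)"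
    by (simp add: extension_def)
  moreover have "cdd_bound (ground {x} {} {}) (vrank (\<lambda>y. case y of Inl x \<Rightarrow> v x | Inr c \<Rightarrow> 0)) 1"
    by (rule cdd_bound.single) auto
  ultimately show ?case by fastforce
next
  case (Node ts)
  define n where "n = length ts"
  define X where "X = (\<lambda>i. set (leaves (ts ! i)))"
  define E where "E = set (leaves (Node ts))"
  define d where "d = fold max (map depth ts) 0"
  have depth: "depth (Node ts) = Suc d" by (simp add: d_def)
  have mem: "ts ! i \<in> set ts" if "i < n" for i using that by (simp add: n_def)
  have "set ts = (\<lambda>i. ts ! i) ` {..<n}" by (auto simp: n_def set_conv_nth)
  then have E: "E = (\<Union>i<n. X i)" by (simp add: E_def X_def)
  have wok: "width_ok (vrank v) r (ts ! i)" if "i < n" for i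
    using Node.prems(2) mem[OF that] by (simp add: list_all_iff)
  have n0: "0 < n" using Node.prems(2) by (simp add: n_def)
  have lam: "lam_star (vrank v) {..<n} X \<le> r" using Node.prems(2) by (simp add: n_def X_def)
  have finX: "finite (X i)" and neX: "i < n \<Longrightarrow> X i \<noteq> {}" for i
    using leaves_nonempty[OF wok] by (auto simp: X_def)
  have disX: "X i \<inter> X j = {}" if "i < n" "j < n" "i \<noteq> j" for i j
  proof -
    have *: "distinct (concat (map leaves ts))" using Node.prems(1) by simp
    have "X i \<inter> X j = {}" if "i < j" "j < n" for i j
      using * that
    proof -
      have ts: "ts = take j ts @ ts ! j # drop (Suc j) ts" using that by (simp add: n_def id_take_nth_drop)
      have "distinct (concat (map leaves (take j ts)) @ leaves (ts ! j) @ concat (map leaves (drop (Suc j) ts)))"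
        using * by (subst (asm) ts) simp
      then have "set (concat (map leaves (take j ts))) \<inter> set (leaves (ts ! j)) = {}" by auto
      moreover have "ts ! i \<in> set (take j ts)" using that by (auto simp: n_def in_set_conv_nth)
      ultimately show ?thesis by (auto simp: X_def)
    qed
    then show ?thesis using that by (metis Int_commute linorder_neqE_nat)
  qed
  define V where "V = (\<lambda>i. fv.span (v ` X i))"
  define U where "U = (\<lambda>i. V i \<inter> fv.span (v ` (\<Union>j<i. X j)))"
  have sU: "fv.subspace (U i)" for i by (simp add: U_def V_def fv.subspace_inter)
  have dimU: "fv.dim (\<Union>i<n. U i) \<le> 3 * r"
    using fv.dim_overlaps_le[OF finX lam] by (simp add: U_def V_def)
  have VE: "V i \<subseteq> fv.span (v ` E)" if "i < n" for i
    unfolding V_def E by (rule fv.span_mono) (use that in auto)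
  have UE: "(\<Union>i<n. U i) \<subseteq> fv.span (v ` E)" using VE by (auto simp: U_def)
  have finE: "finite E" by (simp add: E_def)
  have fdU: "fv.fin_dim (\<Union>i<n. U i)"
    by (rule fv.fin_dim_subset[OF fv.fin_dim_finite UE]) (simp add: finE)
  \<comment> \<open>One basis for the sum of all overlaps: every difference
    \<open>v x - v' x\<close> is a combination of these at most \<open>3 * r\<close> vectors,
    whatever block \<open>x\<close> lies in.\<close>
  obtain W where W: "W \<subseteq> (\<Union>i<n. U i)" "finite W" "(\<Union>i<n. U i) \<subseteq> fv.span W" "card W = fv.dim (\<Union>i<n. U i)"
    using fv.finite_basis_exists[OF fdU] by metis
  have "\<exists>K. fv.subspace K \<and> K \<subseteq> V i \<and> K \<inter> U i = {0} \<and> (\<forall>x\<in>V i. \<exists>c\<in>K. x - c \<in> U i)" for i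
    by (rule fv.complement_exists) (auto simp: U_def V_def fv.subspace_inter)
  then obtain K where K: "\<And>i. fv.subspace (K i)" "\<And>i. K i \<subseteq> V i" "\<And>i. K i \<inter> U i = {0}"
    "\<And>i x. x \<in> V i \<Longrightarrow> \<exists>c\<in>K i. x - c \<in> U i" by metis
  \<comment> \<open>Disjointness makes the block of \<open>x\<close> unique, so the choices in the
    separate blocks combine into one function \<open>v'\<close>.\<close>
  have "\<exists>c. \<forall>i<n. x \<in> X i \<longrightarrow> c \<in> K i \<and> v x - c \<in> U i" if x: "x \<in> E" for x
  proof -
    obtain i where i: "i < n" "x \<in> X i" using x unfolding E by blast
    then have "v x \<in> V i" by (auto simp: V_def intro: fv.span_base)
    then obtain c where c: "c \<in> K i" "v x - c \<in> U i" using K(4) by blast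
    have "j = i" if "j < n" "x \<in> X j" for j using disX[of i j] i that by blast
    then show ?thesis using c by (intro exI[of _ c]) blast
  qed
  then obtain v' where "\<forall>x\<in>E. \<forall>i<n. x \<in> X i \<longrightarrow> v' x \<in> K i \<and> v x - v' x \<in> U i" by metis
  then have v'K: "v' x \<in> K i" and v'U: "v x - v' x \<in> U i" if "i < n" "x \<in> X i" for i x
    using that E by blast+
  have spanK: "fv.span (v' ` Y) \<subseteq> K i" if "i < n" "Y \<subseteq> X i" for i Y
    using that v'K by (intro fv.span_minimal K(1)) blast
  have v'E: "v' ` E \<subseteq> fv.span (v ` E)" using E v'K K(2) VE by blast
  have supp: "v x l = 0" if "x \<in> E" "m \<le> l" for x l using Node.prems(3) that unfolding E_def by blast
  have supp': "v' x l = 0" if "x \<in> E" "m \<le> l" for x l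
  proof (rule span_support[of "v' x" "v ` E" "{..<m}"])
    show "v' x \<in> fv.span (v ` E)" using v'E that by blast
  qed (use supp that in auto)
  \<comment> \<open>Within block \<open>i\<close> the vectors change only modulo \<open>U i\<close>,
    and the new ones lie in the complement \<open>K i\<close>; the increase is thus at most
    \<open>dim (U i)\<close>, itself at most \<open>3 * r\<close>.\<close>
  have width': "width_ok (vrank v') (r + 3 * r) (ts ! i)" if i: "i < n" for i
  proof (rule width_ok_perturb[OF wok[OF i]])
    fix Y Z assume "Y \<subseteq> set (leaves (ts ! i))" "Z \<subseteq> set (leaves (ts ! i))"
    then have YZ: "Y \<union> Z \<subseteq> X i" by (simp add: X_def)
    have fdUi: "fv.fin_dim (U i)" and "fv.dim (U i) \<le> fv.dim (\<Union>i<n. U i)"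
      using i fv.span_superset[of "\<Union>i<n. U i"]
      by (auto intro!: fv.fin_dim_subset[OF fdU] fv.dim_mono_fin_dim[OF fdU])
    moreover have "lam (vrank v') Y Z \<le> lam (vrank v) Y Z + fv.dim (U i)"
    proof (rule fv.lam_perturb_le[OF _ _ fdUi])
      show "finite Y" "finite Z" using YZ finX[of i] by (auto intro: finite_subset)
      show "v x - v' x \<in> fv.span (U i)" if "x \<in> Y \<union> Z" for x
        using v'U[OF i] YZ that by (blast intro: fv.span_base)
      have "fv.span (U i) = U i" using sU by simp
      moreover have "fv.span (v' ` (Y \<union> Z)) \<inter> U i \<subseteq> {0}" using spanK[OF i YZ] K(3)[of i] by blast
      ultimately show "fv.span (v' ` (Y \<union> Z)) \<inter> fv.span (U i) = {0}"
        using fv.span_zero by blast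
    qed
    ultimately show "lam (vrank v') Y Z \<le> lam (vrank v) Y Z + 3 * r" using dimU by linarith
  qed
  have child: "\<exists>C D u. extension v' (X i) m' C D u \<and>
      cdd_bound (ground (X i) C D) (vrank u) (8 * r * (4 ^ d - 1) + 1)" if i: "i < n" and m': "m \<le> m'" for i m'
  proof -
    have "distinct (leaves (ts ! i))"
      using Node.prems(1) mem[OF i] by (simp add: distinct_concat_iff)
    moreover have "v' x l = 0" if "x \<in> set (leaves (ts ! i))" "m' \<le> l" for x l
      using supp'[of x l] that i m' unfolding E X_def by auto
    ultimately obtain C D u where CDu: "extension v' (X i) m' C D u"
      "cdd_bound (ground (X i) C D) (vrank u) (2 * (r + 3 * r) * (4 ^ depth (ts ! i) - 1) + 1)"
      using Node.IH[OF mem[OF i], of v' "r + 3 * r" m'] width'[OF i] unfolding X_def by blast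
    have "depth (ts ! i) \<le> d" using depth_child[OF mem[OF i]] by (simp add: d_def)
    then show ?thesis using CDu cdd_bound_mono[OF CDu(2) cdd_bound_recursion(1)] by blast
  qed
  \<comment> \<open>The new vectors of earlier blocks stay in the old span of those blocks, which
    meets \<open>V i\<close> in \<open>U i\<close>; the new block \<open>i\<close> lies in
    \<open>K i\<close>, and \<open>K i\<close> meets \<open>U i\<close> only in 0.\<close>
  have dir: "fv.span (v' ` (\<Union>j<i. X j)) \<inter> fv.span (v' ` X i) = {0}" if i: "i < n" for i
  proof -
    have "v' ` (\<Union>j<i. X j) \<subseteq> fv.span (v ` (\<Union>j<i. X j))"
    proof
      fix y assume "y \<in> v' ` (\<Union>j<i. X j)"
      then obtain j x where j: "j < i" "x \<in> X j" "y = v' x" by blast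
      then have "y \<in> V j" using v'K[of j x] K(2)[of j] i by auto
      moreover have "V j \<subseteq> fv.span (v ` (\<Union>j<i. X j))"
        unfolding V_def by (rule fv.span_mono) (use j in auto)
      ultimately show "y \<in> fv.span (v ` (\<Union>j<i. X j))" by blast
    qed
    then have "fv.span (v' ` (\<Union>j<i. X j)) \<subseteq> fv.span (v ` (\<Union>j<i. X j))"
      by (rule fv.span_minimal) simp
    then have "fv.span (v' ` (\<Union>j<i. X j)) \<inter> fv.span (v' ` X i) \<subseteq> K i \<inter> U i"
      using spanK[OF i subset_refl] K(2)[of i] unfolding U_def by blast
    then show ?thesis unfolding K(3) using fv.span_zero by blast
  qed
  have "\<exists>C D u. extension v' (\<Union>i<n. X i) m C D u \<and>
      cdd_bound (ground (\<Union>i<n. X i) C D) (vrank u) (8 * r * (4 ^ d - 1) + 1)"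
  proof (rule extension_UN[OF n0])
    show "v' x l = 0" if "i < n" "x \<in> X i" "m \<le> l" for i x l using supp'[of x l] that E by blast
  qed (use finX neX disX dir child in auto)
  then obtain C D u where CDu: "extension v' E m C D u"
    "cdd_bound (ground E C D) (vrank u) (8 * r * (4 ^ d - 1) + 1)" unfolding E by blast
  have "\<exists>C D u. extension v E m C D u \<and>
      cdd_bound (ground E C D) (vrank u) (8 * r * (4 ^ d - 1) + 1 + 2 * card W)"
  proof (rule extension_perturb[OF CDu(1) finE W(2) _ v'E _ _ CDu(2)])
    show "W \<subseteq> fv.span (v ` E)" using W(1) UE by blast
    show "v x - v' x \<in> fv.span W" if "x \<in> E" for x using that E v'U W(3) by blast
    show "v x i = 0" if "x \<in> E" "m \<le> i" for x i using supp that .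
  qed
  moreover have "8 * r * (4 ^ d - 1) + 1 + 2 * card W \<le> 2 * r * (4 ^ depth (Node ts) - 1) + 1"
    using cdd_bound_recursion(2)[OF order_refl, of r d] W(4) dimU depth by simp
  ultimately show ?case unfolding E_def[symmetric] using cdd_bound_mono by blast
qed

theorem theorem4p1:
  fixes E :: "'a set" and rk :: "'a set \<Rightarrow> nat" and d r :: nat
  assumes "representable TYPE('f::field) E rk"
    and "has_rooted_decomposition E rk d r"
  shows "\<exists>(E' :: ('a + nat) set) rk'. representable TYPE('f) E' rk' \<and>
           is_minor E rk E' rk' \<and> cdd E' rk' \<le> 2 * r * (4 ^ d - 1) + 1"
proof -
  obtain v :: "'a \<Rightarrow> nat \<Rightarrow> 'f" and m where fin: "finite E"
    and supp: "\<And>x i. x \<in> E \<Longrightarrow> m \<le> i \<Longrightarrow> v x i = 0" and rk: "\<And>X. X \<subseteq> E \<Longrightarrow> rk X = lin_rank v X"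
    using assms(1) unfolding representable_def by blast
  obtain T where T: "distinct (leaves T)" "set (leaves T) = E" "depth T = d" "width_ok rk r T"
    using assms(2) unfolding has_rooted_decomposition_def rooted_decomposition_def by blast
  have rk_eq: "rk X = vrank v X" if "X \<subseteq> E" for X
    using rk[OF that] lin_rank_eq_vrank[of X v] finite_subset[OF that fin] by simp
  have "width_ok (vrank v) (r + 0) T"
    by (rule width_ok_perturb[OF T(4)]) (simp add: T(2) lam_def rk_eq)
  then obtain C D u where ext: "extension v E m C D u"
    and bound: "cdd_bound (ground E C D) (vrank u) (2 * r * (4 ^ d - 1) + 1)"
    using decomposition_extension[of T v r m] T supp by auto
  have CD: "finite C" "finite D" "C \<inter> D = {}" using ext by (simp_all add: extension_def)
  let ?E = "ground E C D"
  have finE: "finite ?E" using fin CD by simp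
  \<comment> \<open>A representation has finitely many rows: the coordinates in use lie below
    \<open>m\<close> or in the finite set \<open>C\<close>.\<close>
  obtain b where "\<forall>c\<in>C. c < b" using CD(1) finite_nat_set_iff_bounded by blast
  then have "u y i = 0" if y: "y \<in> ?E" and i: "max b m \<le> i" for y i
  proof -
    have "u y \<in> fv.span (v ` E \<union> unit_vec ` C)" using extension_span[OF ext] y by blast
    then show ?thesis
      by (rule span_support[where A = "{..<max b m}"])
        (use supp i \<open>\<forall>c\<in>C. c < b\<close> in \<open>auto simp: unit_vec_def\<close>)
  qed
  then have "representable TYPE('f) ?E (lin_rank u)"
    unfolding representable_def using finE by blast
  moreover have lin: "lin_rank u Y = vrank u Y" if "Y \<subseteq> ?E" for Y
    using lin_rank_eq_vrank finite_subset[OF that finE] by blast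
  have "is_minor E rk ?E (lin_rank u)"
    unfolding is_minor_def
  proof (intro exI conjI allI impI)
    show "Inr ` C \<subseteq> ?E" "Inr ` D \<subseteq> ?E" by auto
    show "Inr ` C \<inter> Inr ` D = {}" using CD(3) by auto
    show "inj_on Inl E" by simp
    show "Inl ` E = ?E - Inr ` C - Inr ` D" by auto
    fix X assume X: "X \<subseteq> E"
    have "vrank v X = vrank u (Inl ` X \<union> Inr ` C) - vrank u (Inr ` C)"
      by (rule extension_rank[OF ext X finite_subset[OF X fin] supp])
    moreover have "Inl ` X \<union> Inr ` C \<subseteq> ?E" "Inr ` C \<subseteq> ?E" using X by auto
    ultimately show "rk X = lin_rank u (Inl ` X \<union> Inr ` C) - lin_rank u (Inr ` C)"
      using rk_eq[OF X] lin by simp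
  qed
  moreover have "cdd_le ?E (lin_rank u) (2 * r * (4 ^ d - 1) + 1)"
  proof (rule cdd_bound_imp_cdd_le)
    show "cdd_bound ?E (lin_rank u) (2 * r * (4 ^ d - 1) + 1)" by (rule cdd_bound_cong[OF bound lin])
    have "matroid_rank ?E (vrank u)" by (rule fv.matroid_rank_dim[OF finE])
    then show "matroid_rank ?E (lin_rank u)" unfolding matroid_rank_def by (simp add: lin le_infI1)
  qed
  then have "cdd ?E (lin_rank u) \<le> 2 * r * (4 ^ d - 1) + 1" unfolding cdd_def by (rule Least_le)
  ultimately show ?thesis by blast
qed

end
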